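(* Let $I\subseteq[0,\infty)$ be a closed interval, and let $\{X_1(t),\,t\geq 0\}$ and $\{X_2(t),\,t\geq 0\}$ be dilatively stable processes with parameters $(\alpha_1,\delta_1)$ and $(\alpha_2,\delta_2)$, respectively, both processes with zero mean, and having sample paths in $C(I)$ almost surely. Assume that one of the following two conditions holds: • $\inf\{t: t\in I\}=0$ (i.e. the left endpoint of $I$ is zero), and for each $i\in\{1,2\}$: if $\delta_i\geq 0$, then the distribution of $X_i(1)$ (equivalently, the distribution of $X_i(t)$ for any $t>0$) has a Gaussian component; • $\sup\{t: t\in I\}=\infty$ (i.e. $I$ is unbounded), and for each $i\in\{1,2\}$: if $\delta_i\leq 0$, then the distribution of $X_i(1)$ (equivalently, the distribution of $X_i(t)$ for any $t>0$) has a Gaussian component. Then $\alpha_1\neq\alpha_2$ implies that $X_1$ and $X_2$ are singular on $I$, i.e. $X_1\,\bot\,X_2$.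
   Context: Processes are real-valued; $\overset{\mathrm{fd}}{\sim}$ denotes equality of all finite-dimensional distributions. For a process $X=\{X(t),t\ge0\}$ all of whose finite-dimensional distributions are infinitely divisible and for $c>0$, $X^{\circledast c}=\{X(t),t\ge0\}^{\circledast c}$ denotes a process whose finite-dimensional distributions are the $c$-th convolution powers of the corresponding finite-dimensional distributions of $X$ (i.e. characteristic functions are raised to the power $c$). Let $\alpha>0$ and $\delta\leq 2\alpha$. A process $\{X(t),t\ge 0\}$ starting from zero ($X(0)=0$) is called $(\alpha,\delta)$-dilatively stable (dilatively stable with parameters $(\alpha,\delta)$) if its finite-dimensional distributions are infinitely divisible, $X(1)$ is non-Gaussian, $X(t)$ has finite moments of all orders for all $t\ge0$, and for all $T>0$, $X(T\,\cdot\,)\overset{\mathrm{fd}}{\sim}T^{\alpha-\delta/2}X^{\circledast T^\delta}(\,\cdot\,)$. Zero mean means $\mathsf{E}X(t)=0$ for all $t\geq 0$. An infinitely divisible distribution is said to have a Gaussian component if in its Lévy–Khintchine representation the Gaussian part has positive variance. $C(I)$ denotes the set of continuous real functions on the closed interval $I\subseteq[0,\infty)$ with the local uniform topology and Borel $\sigma$-algebra $\mathcal{B}(C(I))$. If $\{X_1(t),t\in I\}$ and $\{X_2(t),t\in I\}$ have sample paths in $C(I)$ a.s., they are called singular on $I$ (in notation $X_1\,\bot\,X_2$) if their distributions $\mathsf{P}_{X_1},\mathsf{P}_{X_2}$ on $(C(I),\mathcal{B}(C(I)))$ are singular, i.e. there exists a set $A\in\mathcal{B}(C(I))$ with $\mathsf{P}_{X_1}(A)=1$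 and $\mathsf{P}_{X_2}(A)=0$. *)

theory Defs
  imports "HOL-Probability.Probability"
begin

text \<open>
  A process is a function \<open>X :: real \<Rightarrow> 'a \<Rightarrow> real\<close> together with a probability space \<open>M\<close>; only
  the times \<open>t \<ge> 0\<close> matter.
\<close>

definition real_process :: "'a measure \<Rightarrow> (real \<Rightarrow> 'a \<Rightarrow> real) \<Rightarrow> bool" where
  "real_process M X \<longleftrightarrow> prob_space M \<and> (\<forall>t\<ge>0. X t \<in> borel_measurable M)"

definition fin_dim_distr ::
    "'a measure \<Rightarrow> (real \<Rightarrow> 'a \<Rightarrow> real) \<Rightarrow> real set \<Rightarrow> (real \<Rightarrow> real) measure" where
  "fin_dim_distr M X J = distr M (PiM J (\<lambda>_. borel)) (\<lambda>\<omega>. \<lambda>t\<in>J. X t \<omega>)"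

definition fd_equal ::
    "'a measure \<Rightarrow> (real \<Rightarrow> 'a \<Rightarrow> real) \<Rightarrow> 'b measure \<Rightarrow> (real \<Rightarrow> 'b \<Rightarrow> real) \<Rightarrow> bool" where
  "fd_equal M X N Y \<longleftrightarrow>
     (\<forall>J. finite J \<and> J \<subseteq> {0..} \<longrightarrow> fin_dim_distr M X J = fin_dim_distr N Y J)"

text \<open>
  \<open>\<mu>\<close> is a distribution on \<open>\<real>\<^sup>J\<close>, and for every \<open>n \<ge> 1\<close> it has to be the law of the sum of \<open>n\<close>
  independent vectors with a common law \<open>\<nu>\<close>.
\<close>

definition infinitely_divisible :: "real set \<Rightarrow> (real \<Rightarrow> real) measure \<Rightarrow> bool" where
  "infinitely_divisible J \<mu> \<longleftrightarrow>
     (\<forall>n::nat. n \<ge> 1 \<longrightarrow> (\<exists>\<nu>. prob_space \<nu> \<and> sets \<nu> = sets (PiM J (\<lambda>_. borel)) \<and>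
        \<mu> = distr (PiM {..<n} (\<lambda>_. \<nu>)) (PiM J (\<lambda>_. borel))
              (\<lambda>\<omega>. \<lambda>t\<in>J. \<Sum>i<n. \<omega> i t)))"

definition joint_char ::
    "real set \<Rightarrow> (real \<Rightarrow> real) measure \<Rightarrow> (real \<Rightarrow> real) \<Rightarrow> complex" where
  "joint_char J \<mu> \<theta> = (CLINT x|\<mu>. iexp (\<Sum>t\<in>J. \<theta> t * x t))"

text \<open>
  The real power of the (non-vanishing) characteristic function of an infinitely divisible law is
  taken with its distinguished logarithm: the unique \<open>\<psi>\<close> that is continuous, vanishes at \<open>0\<close> and
  satisfies \<open>exp \<psi> = joint_char J \<mu>\<close>.  The principal branch of the logarithm would be wrong here.
  The argument \<open>\<theta>\<close> ranges over all functions, but only its restriction to the finite set \<open>J\<close>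
  matters, so continuity in the product topology is continuity on \<open>\<real>\<^sup>J\<close>.
\<close>

definition is_conv_power ::
    "real set \<Rightarrow> real \<Rightarrow> (real \<Rightarrow> real) measure \<Rightarrow> (real \<Rightarrow> real) measure \<Rightarrow> bool" where
  "is_conv_power J c \<mu> \<nu> \<longleftrightarrow>
     (\<exists>\<psi>::(real \<Rightarrow> real) \<Rightarrow> complex.
        continuous_on UNIV \<psi> \<and> \<psi> (\<lambda>_. 0) = 0 \<and>
        (\<forall>\<theta>. joint_char J \<mu> \<theta> = exp (\<psi> \<theta>)) \<and>
        (\<forall>\<theta>. joint_char J \<nu> \<theta> = exp (of_real c * \<psi> \<theta>)))"

text \<open>\<open>(N, Y)\<close> is a version of the convolution power with exponent \<open>c\<close> of \<open>(M, X)\<close>.\<close>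

definition is_conv_power_process ::
    "real \<Rightarrow> 'a measure \<Rightarrow> (real \<Rightarrow> 'a \<Rightarrow> real) \<Rightarrow> 'b measure \<Rightarrow> (real \<Rightarrow> 'b \<Rightarrow> real) \<Rightarrow> bool" where
  "is_conv_power_process c M X N Y \<longleftrightarrow>
     real_process N Y \<and>
     (\<forall>J. finite J \<and> J \<subseteq> {0..} \<longrightarrow>
        is_conv_power J c (fin_dim_distr M X J) (fin_dim_distr N Y J))"

text \<open>Point masses count as (degenerate) Gaussian laws.\<close>

definition gaussian_law :: "real measure \<Rightarrow> bool" where
  "gaussian_law \<mu> \<longleftrightarrow>
     (\<exists>m. \<mu> = return borel m \<or> (\<exists>\<sigma>>0. \<mu> = density lborel (normal_density m \<sigma>)))"

text \<open>
  The convolution power process is determined only up to finite-dimensional distributions; by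
  Kolmogorov's extension theorem it is no restriction to let it live on a probability space of
  functions \<open>real \<Rightarrow> real\<close>.
\<close>

definition dilatively_stable ::
    "'a measure \<Rightarrow> (real \<Rightarrow> 'a \<Rightarrow> real) \<Rightarrow> real \<Rightarrow> real \<Rightarrow> bool" where
  "dilatively_stable M X \<alpha> \<delta> \<longleftrightarrow>
     \<alpha> > 0 \<and> \<delta> \<le> 2 * \<alpha> \<and>
     real_process M X \<and>
     (AE \<omega> in M. X 0 \<omega> = 0) \<and>
     (\<forall>J. finite J \<and> J \<subseteq> {0..} \<longrightarrow> infinitely_divisible J (fin_dim_distr M X J)) \<and>
     \<not> gaussian_law (distr M borel (X 1)) \<and>
     (\<forall>t\<ge>0. \<forall>k::nat. integrable M (\<lambda>\<omega>. X t \<omega> ^ k)) \<and>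
     (\<forall>T>0. \<exists>(N :: (real \<Rightarrow> real) measure) Y.
        is_conv_power_process (T powr \<delta>) M X N Y \<and>
        fd_equal M (\<lambda>t. X (T * t)) N (\<lambda>t \<omega>. T powr (\<alpha> - \<delta> / 2) * Y t \<omega>))"

definition levy_measure :: "real measure \<Rightarrow> bool" where
  "levy_measure \<nu> \<longleftrightarrow>
     sets \<nu> = sets borel \<and> emeasure \<nu> {0} = 0 \<and>
     (\<integral>\<^sup>+ x. ennreal (min 1 (x\<^sup>2)) \<partial>\<nu>) < \<infinity>"

text \<open>\<open>v\<close> is the variance of the Gaussian part; it does not depend on the truncation function.\<close>

definition levy_khintchine :: "real measure \<Rightarrow> real \<Rightarrow> real \<Rightarrow> real measure \<Rightarrow> bool" where
  "levy_khintchine \<mu> b v \<nu> \<longleftrightarrow>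
     v \<ge> 0 \<and> levy_measure \<nu> \<and>
     (\<forall>\<theta>::real. char \<mu> \<theta> =
        exp (\<i> * of_real (b * \<theta>) - of_real (v * \<theta>\<^sup>2 / 2) +
          (CLINT x|\<nu>. iexp (\<theta> * x) - 1 - \<i> * of_real (\<theta> * x * indicator {-1..1} x))))"

definition has_gaussian_component :: "real measure \<Rightarrow> bool" where
  "has_gaussian_component \<mu> \<longleftrightarrow> (\<exists>b v \<nu>. levy_khintchine \<mu> b v \<nu> \<and> v > 0)"

text \<open>Elements of \<open>C(I)\<close> are represented by functions that are \<open>undefined\<close> outside \<open>I\<close>.\<close>

definition cont_paths :: "real set \<Rightarrow> (real \<Rightarrow> real) set" where
  "cont_paths I = {f \<in> extensional I. continuous_on I f}"

definition local_uniform_topology :: "real set \<Rightarrow> (real \<Rightarrow> real) topology" where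
  "local_uniform_topology I = topology_generated_by
     {{g \<in> cont_paths I. \<forall>t\<in>K. \<bar>g t - f t\<bar> < \<epsilon>} | f K \<epsilon>.
        f \<in> cont_paths I \<and> compact K \<and> K \<subseteq> I \<and> \<epsilon> > 0}"

definition borel_cont_paths :: "real set \<Rightarrow> (real \<Rightarrow> real) measure" where
  "borel_cont_paths I = sigma (cont_paths I) {U. openin (local_uniform_topology I) U}"

text \<open>
  The distribution on \<open>C(I)\<close> of a process whose paths are almost surely continuous on \<open>I\<close>.  The
  event that a path is continuous is known to be measurable only with respect to the completion;
  on the null set of discontinuous paths, the path is replaced by the zero function, which does
  not affect the distribution.
\<close>

definition path_distr ::
    "real set \<Rightarrow> 'a measure \<Rightarrow> (real \<Rightarrow> 'a \<Rightarrow> real) \<Rightarrow> (real \<Rightarrow> real) measure" where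
  "path_distr I M X = distr (completion M) (borel_cont_paths I)
     (\<lambda>\<omega>. if continuous_on I (\<lambda>t. X t \<omega>) then (\<lambda>t\<in>I. X t \<omega>) else (\<lambda>t\<in>I. 0))"

definition singular_on ::
    "real set \<Rightarrow> 'a measure \<Rightarrow> (real \<Rightarrow> 'a \<Rightarrow> real) \<Rightarrow> 'b measure \<Rightarrow> (real \<Rightarrow> 'b \<Rightarrow> real) \<Rightarrow> bool" where
  "singular_on I M X N Y \<longleftrightarrow>
     (\<exists>A\<in>sets (borel_cont_paths I).
        emeasure (path_distr I M X) A = 1 \<and> emeasure (path_distr I N Y) A = 0)"

end

theory Submission
  imports Defs
begin

text \<open>
  Pick times \<open>t\<^sub>k\<close> in \<open>I\<close> tending to \<open>0\<close> (or to \<open>\<infinity>\<close>) and \<open>\<beta> = (\<alpha>\<^sub>1 + \<alpha>\<^sub>2) / 2\<close>.  Dilative stability gives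
  \<open>E X\<^sub>i(t)\<^sup>2 = t\<^bsup>2\<alpha>\<^esup> E X\<^sub>i(1)\<^sup>2\<close> with \<open>\<alpha> = \<alpha>\<^sub>i\<close>, so by Chebyshev one of the processes satisfies
  \<open>\<bar>X(t\<^sub>k)\<bar> \<le> t\<^sub>k\<^bsup>\<beta>\<^esup>\<close> with probability tending to \<open>1\<close>.  For the other one this probability tends to \<open>0\<close>:
  if \<open>\<phi>\<close> is the characteristic function of \<open>X(1)\<close>, then that of \<open>X(t) / t\<^bsup>\<alpha>\<^esup>\<close> has modulus
  \<open>\<bar>\<phi>(s t\<^bsup>-\<delta>/2\<^esup>)\<bar>\<^bsup>c\<^esup>\<close> with \<open>c = t\<^bsup>\<delta>\<^esup>\<close>.  A bound \<open>\<bar>\<phi>(s)\<bar> \<le> exp (- v s\<^sup>2)\<close> is invariant under this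
  scaling; it holds for all \<open>s\<close> if there is a Gaussian component, and near \<open>0\<close> in any case, which
  suffices when \<open>c \<longlongrightarrow> \<infinity>\<close>.  Hence \<open>X(t) / t\<^bsup>\<alpha>\<^esup>\<close> cannot concentrate at \<open>0\<close>.  Borel--Cantelli along a
  subsequence turns the two limits into singularity.
\<close>

section \<open>Measurability in the space of continuous paths\<close>

text \<open>
  Every open set is a union of tubes, of which there are only countably many since their data are
  rational.  Hence the path map is measurable; otherwise \<open>distr\<close> in \<open>path_distr\<close> would be junk.
\<close>

definition tube :: "real set \<Rightarrow> (rat \<times> rat \<times> rat \<times> rat) set \<Rightarrow> (real \<Rightarrow> real) set" where
  "tube I F = {g \<in> cont_paths I. \<forall>(p, q, a, b)\<in>F. \<forall>t\<in>I \<inter> {of_rat p..of_rat q}.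
     of_rat a \<le> g t \<and> g t \<le> of_rat b}"

lemma tube_subset: "tube I F \<subseteq> cont_paths I"
  by (auto simp: tube_def)

lemma tube_Un: "tube I (F \<union> G) = tube I F \<inter> tube I G"
  unfolding tube_def ball_Un by blast

lemma rat_interval_nhd:
  fixes t d :: real
  assumes "d > 0"
  obtains p q :: rat where "of_rat p < t" "t < of_rat q" "{of_rat p..of_rat q} \<subseteq> ball t d"
proof -
  obtain p :: rat where p: "t - d < of_rat p" "of_rat p < t"
    using of_rat_dense[of "t - d" t] assms by auto
  obtain q :: rat where q: "t < of_rat q" "of_rat q < t + d"
    using of_rat_dense[of t "t + d"] assms by auto
  show thesis
    by (rule that[OF p(2) q(1)]) (use p q in \<open>auto simp: dist_real_def\<close>)
qed

text \<open>Near each point of \<open>K\<close>, continuity traps \<open>g\<close> in a rational box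
  that also forces closeness to \<open>f\<close>. Compactness of \<open>K\<close> leaves finitely
  many such boxes.\<close>

lemma tube_nhd_ball:
  assumes f: "f \<in> cont_paths I" and g: "g \<in> cont_paths I" and K: "compact K" "K \<subseteq> I"
    and less: "\<And>t. t \<in> K \<Longrightarrow> \<bar>g t - f t\<bar> < \<epsilon>"
  shows "\<exists>F. finite F \<and> g \<in> tube I F \<and> tube I F \<subseteq> {h \<in> cont_paths I. \<forall>t\<in>K. \<bar>h t - f t\<bar> < \<epsilon>}"
proof -
  \<comment> \<open>The admissible boxes: over the interval from \<open>p\<close> to
    \<open>q\<close>, the range from \<open>a\<close> to \<open>b\<close> contains the values of
    \<open>g\<close> and lies strictly within \<open>\<epsilon>\<close> of those of
    \<open>f\<close>.\<close>
  define G :: "(rat \<times> rat \<times> rat \<times> rat) set" where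
    "G = {(p, q, a, b). \<forall>s\<in>I \<inter> {of_rat p..of_rat q}. of_rat a \<le> g s \<and> g s \<le> of_rat b \<and>
         f s - \<epsilon> < of_rat a \<and> of_rat b < f s + \<epsilon>}"
  define V where "V = (\<lambda>(p :: rat, q :: rat, a :: rat, b :: rat). {of_rat p<..<of_rat q :: real})"
  have "\<exists>x\<in>G. t \<in> V x" if t: "t \<in> K" for t
  proof -
    \<comment> \<open>A quarter of the slack at \<open>t\<close>: rounding to \<open>a\<close> and
      \<open>b\<close> costs less than \<open>2 * \<eta>\<close> and the variation of
      \<open>f\<close> less than \<open>\<eta>\<close>, so a margin remains.\<close>
    define \<eta> where "\<eta> = (\<epsilon> - \<bar>g t - f t\<bar>) / 4"
    have \<eta>: "\<eta> > 0" "\<bar>g t - f t\<bar> = \<epsilon> - 4 * \<eta>"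
      using less[OF t] by (simp_all add: \<eta>_def field_simps)
    have tI: "t \<in> I" using K t by auto
    obtain d1 where d1: "d1 > 0" "\<And>s. s \<in> I \<Longrightarrow> dist s t < d1 \<Longrightarrow> dist (f s) (f t) < \<eta>"
      using f tI \<eta>(1) unfolding cont_paths_def continuous_on_iff by blast
    obtain d2 where d2: "d2 > 0" "\<And>s. s \<in> I \<Longrightarrow> dist s t < d2 \<Longrightarrow> dist (g s) (g t) < \<eta>"
      using g tI \<eta>(1) unfolding cont_paths_def continuous_on_iff by blast
    obtain p q :: rat where pq: "of_rat p < t" "t < of_rat q"
        "{of_rat p..of_rat q} \<subseteq> ball t (min d1 d2)"
      using rat_interval_nhd[of "min d1 d2" t] d1 d2 by auto
    obtain a :: rat where a: "g t - 2 * \<eta> < of_rat a" "of_rat a < g t - \<eta>"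
      using of_rat_dense[of "g t - 2 * \<eta>" "g t - \<eta>"] \<eta> by auto
    obtain b :: rat where b: "g t + \<eta> < of_rat b" "of_rat b < g t + 2 * \<eta>"
      using of_rat_dense[of "g t + \<eta>" "g t + 2 * \<eta>"] \<eta> by auto
    have "of_rat a \<le> g s \<and> g s \<le> of_rat b \<and> f s - \<epsilon> < of_rat a \<and> of_rat b < f s + \<epsilon>"
      if s: "s \<in> I \<inter> {of_rat p..of_rat q}" for s
    proof -
      have "dist s t < min d1 d2"
        using pq(3) s by (auto simp: dist_commute)
      then have "\<bar>f s - f t\<bar> < \<eta>" "\<bar>g s - g t\<bar> < \<eta>"
        using d1(2)[of s] d2(2)[of s] s by (auto simp: dist_real_def)
      then show ?thesis using a b \<eta>(2) by argo
    qed
    then have "(p, q, a, b) \<in> G" by (simp add: G_def)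
    moreover have "t \<in> V (p, q, a, b)" using pq by (simp add: V_def)
    ultimately show ?thesis by blast
  qed
  then have cover: "K \<subseteq> (\<Union>x\<in>G. V x)" by blast
  have "open (V x)" for x by (simp add: V_def split: prod.split)
  from compactE_image[OF K(1) this cover] obtain F
    where F: "F \<subseteq> G" "finite F" "K \<subseteq> (\<Union>x\<in>F. V x)" .
  have "g \<in> tube I F"
    using F(1) g by (fastforce simp: tube_def G_def)
  moreover have "\<bar>h t - f t\<bar> < \<epsilon>" if h: "h \<in> tube I F" and t: "t \<in> K" for h t
  proof -
    obtain p q a b where x: "(p, q, a, b) \<in> F" "t \<in> {of_rat p<..<of_rat q}"
      using F(3) t by (fastforce simp: V_def)
    then have tI: "t \<in> I \<inter> {of_rat p..of_rat q}" using t K by auto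
    have "of_rat a \<le> h t \<and> h t \<le> of_rat b"
      using h tI x(1) by (fastforce simp: tube_def)
    moreover have "f t - \<epsilon> < of_rat a \<and> of_rat b < f t + \<epsilon>"
      using x(1) F(1) tI by (fastforce simp: G_def)
    ultimately show ?thesis by argo
  qed
  ultimately show ?thesis using F(2) tube_subset[of I F] by blast
qed

text \<open>Induction on the generation of the topology: subbasic sets are handled by
  \<open>tube_nhd_ball\<close>, intersections by joining the two families of constraints.\<close>

lemma tube_nhd_open:
  assumes "openin (local_uniform_topology I) U" and "g \<in> U"
  shows "\<exists>F. finite F \<and> g \<in> tube I F \<and> tube I F \<subseteq> U"
  using assms unfolding local_uniform_topology_def openin_topology_generated_by_iff
proof (induction arbitrary: g rule: generate_topology_on.induct)
  case Empty
  then show ?case by simp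
next
  case (Int A B)
  then obtain F G where "finite F" "g \<in> tube I F" "tube I F \<subseteq> A"
    "finite G" "g \<in> tube I G" "tube I G \<subseteq> B" by blast
  then show ?case by (intro exI[of _ "F \<union> G"]) (auto simp: tube_Un)
next
  case (UN K)
  then obtain S where S: "S \<in> K" "g \<in> S" by blast
  then obtain F where "finite F" "g \<in> tube I F" "tube I F \<subseteq> S"
    using UN.IH by blast
  then show ?case using S(1) by blast
next
  case (Basis S)
  then obtain f K \<epsilon> where S: "S = {g \<in> cont_paths I. \<forall>t\<in>K. \<bar>g t - f t\<bar> < \<epsilon>}"
    and f: "f \<in> cont_paths I" and K: "compact K" "K \<subseteq> I"
    by blast
  have "g \<in> cont_paths I" "\<And>t. t \<in> K \<Longrightarrow> \<bar>g t - f t\<bar> < \<epsilon>"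
    using Basis.prems S by auto
  then show ?case
    unfolding S by (rule tube_nhd_ball[OF f _ K])
qed

lemma openin_eq_Union_tubes:
  assumes "openin (local_uniform_topology I) U"
  shows "U = (\<Union>F\<in>{F. finite F \<and> tube I F \<subseteq> U}. tube I F)"
proof (intro set_eqI iffI)
  fix g assume "g \<in> U"
  from tube_nhd_open[OF assms this] show "g \<in> (\<Union>F\<in>{F. finite F \<and> tube I F \<subseteq> U}. tube I F)"
    by blast
qed blast

lemma openin_local_uniform_subset:
  assumes "openin (local_uniform_topology I) U"
  shows "U \<subseteq> cont_paths I"
proof
  fix g assume "g \<in> U"
  from tube_nhd_open[OF assms this] show "g \<in> cont_paths I"
    using tube_subset by blast
qed

lemma openin_local_uniform_Pow: "{U. openin (local_uniform_topology I) U} \<subseteq> Pow (cont_paths I)"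
  using openin_local_uniform_subset by auto

lemma space_borel_cont_paths [simp]: "space (borel_cont_paths I) = cont_paths I"
  unfolding borel_cont_paths_def by (rule space_measure_of[OF openin_local_uniform_Pow])

lemma sets_borel_cont_paths:
  "sets (borel_cont_paths I) = sigma_sets (cont_paths I) {U. openin (local_uniform_topology I) U}"
  unfolding borel_cont_paths_def by (rule sets_measure_of[OF openin_local_uniform_Pow])

lemma borel_cont_paths_eval:
  assumes "t \<in> I"
  shows "(\<lambda>f. f t) \<in> borel_measurable (borel_cont_paths I)"
proof (rule borel_measurableI)
  fix S :: "real set" assume S: "open S"
  \<comment> \<open>Subbasic neighbourhoods for the compact set \<open>{t}\<close>. Their union may
    be uncountable, but it is open and hence measurable.\<close>
  define \<B> where "\<B> = {{g \<in> cont_paths I. \<forall>s\<in>{t}. \<bar>g s - f s\<bar> < \<epsilon>} | f \<epsilon>.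
    f \<in> cont_paths I \<and> \<epsilon> > 0 \<and> ball (f t) \<epsilon> \<subseteq> S}"
  have "(\<lambda>f. f t) -` S \<inter> cont_paths I = \<Union>\<B>"
  proof (intro set_eqI iffI)
    fix f assume "f \<in> (\<lambda>f. f t) -` S \<inter> cont_paths I"
    then have f: "f \<in> cont_paths I" "f t \<in> S" by auto
    then obtain e where "e > 0" "ball (f t) e \<subseteq> S" using S open_contains_ball by blast
    then have "{g \<in> cont_paths I. \<forall>s\<in>{t}. \<bar>g s - f s\<bar> < e} \<in> \<B>"
      using f unfolding \<B>_def by blast
    moreover have "f \<in> {g \<in> cont_paths I. \<forall>s\<in>{t}. \<bar>g s - f s\<bar> < e}" using f \<open>e > 0\<close> by auto
    ultimately show "f \<in> \<Union>\<B>" by blast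
  next
    fix g assume "g \<in> \<Union>\<B>"
    then show "g \<in> (\<lambda>f. f t) -` S \<inter> cont_paths I"
      by (auto simp: \<B>_def dist_real_def abs_minus_commute subset_iff)
  qed
  moreover have "openin (local_uniform_topology I) (\<Union>\<B>)"
  proof (rule openin_Union)
    fix X assume "X \<in> \<B>"
    then obtain f \<epsilon> where "X = {g \<in> cont_paths I. \<forall>s\<in>{t}. \<bar>g s - f s\<bar> < \<epsilon>}"
      "f \<in> cont_paths I" "\<epsilon> > 0" unfolding \<B>_def by blast
    moreover have "compact {t}" "{t} \<subseteq> I" using assms by auto
    ultimately show "openin (local_uniform_topology I) X"
      unfolding local_uniform_topology_def
      by (intro topology_generated_by_Basis CollectI exI conjI) assumption+
  qed
  ultimately show "(\<lambda>f. f t) -` S \<inter> space (borel_cont_paths I) \<in> sets (borel_cont_paths I)"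
    unfolding space_borel_cont_paths sets_borel_cont_paths
    by (simp only: sigma_sets.Basic mem_Collect_eq)
qed

text \<open>An open set is a countable union of tubes, and continuity of the paths reduces each tube
  to countably many conditions on coordinates.\<close>

lemma measurable_borel_cont_paths:
  assumes path: "\<And>\<omega>. \<omega> \<in> space N \<Longrightarrow> Z \<omega> \<in> cont_paths I"
    and eval: "\<And>t. t \<in> I \<Longrightarrow> (\<lambda>\<omega>. Z \<omega> t) \<in> borel_measurable N"
  shows "Z \<in> N \<rightarrow>\<^sub>M borel_cont_paths I"
  unfolding borel_cont_paths_def
proof (rule measurable_measure_of)
  show "{U. openin (local_uniform_topology I) U} \<subseteq> Pow (cont_paths I)"
    by (rule openin_local_uniform_Pow)
  show "Z \<in> space N \<rightarrow> cont_paths I" using path by blast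
  have box: "{\<omega> \<in> space N. \<forall>t\<in>I \<inter> {p..q}. a \<le> Z \<omega> t \<and> Z \<omega> t \<le> b} \<in> sets N" for p q a b
  proof -
    \<comment> \<open>The bounds need testing only on a countable dense subset; being non-strict,
      they survive limits along it.\<close>
    obtain D where D: "countable D" "D \<subseteq> I \<inter> {p..q}" "I \<inter> {p..q} \<subseteq> closure D"
      using separable[of "I \<inter> {p..q}"] by blast
    have "(\<forall>t\<in>I \<inter> {p..q}. a \<le> Z \<omega> t \<and> Z \<omega> t \<le> b) \<longleftrightarrow> (\<forall>t\<in>D. a \<le> Z \<omega> t \<and> Z \<omega> t \<le> b)"
      if \<omega>: "\<omega> \<in> space N" for \<omega>
    proof
      assume *: "\<forall>t\<in>D. a \<le> Z \<omega> t \<and> Z \<omega> t \<le> b"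
      have cont: "continuous_on (I \<inter> {p..q}) (Z \<omega>)"
        using path[OF \<omega>] by (auto simp: cont_paths_def intro: continuous_on_subset)
      show "\<forall>t\<in>I \<inter> {p..q}. a \<le> Z \<omega> t \<and> Z \<omega> t \<le> b"
      proof
        fix t assume t: "t \<in> I \<inter> {p..q}"
        then obtain u where u: "\<And>n. u n \<in> D" "u \<longlonglongrightarrow> t"
          using D(3) closure_sequential[of t D] by blast
        have "(\<lambda>n. Z \<omega> (u n)) \<longlonglongrightarrow> Z \<omega> t"
          by (rule continuous_on_tendsto_compose[OF cont u(2) t]) (use u(1) D(2) in \<open>blast intro!: always_eventually\<close>)+
        then show "a \<le> Z \<omega> t \<and> Z \<omega> t \<le> b"
          using * u(1) by (blast intro: LIMSEQ_le_const LIMSEQ_le_const2)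
      qed
    qed (use D in blast)
    then have "{\<omega> \<in> space N. \<forall>t\<in>I \<inter> {p..q}. a \<le> Z \<omega> t \<and> Z \<omega> t \<le> b} =
        {\<omega> \<in> space N. \<forall>t\<in>D. a \<le> Z \<omega> t \<and> Z \<omega> t \<le> b}" by blast
    also have "\<dots> \<in> sets N"
    proof (rule sets.sets_Collect_countable_All'[OF _ D(1)])
      fix t assume "t \<in> D"
      then have [measurable]: "(\<lambda>\<omega>. Z \<omega> t) \<in> borel_measurable N" using D eval by blast
      show "{\<omega> \<in> space N. a \<le> Z \<omega> t \<and> Z \<omega> t \<le> b} \<in> sets N" by measurable
    qed
    finally show ?thesis .
  qed
  have tube: "Z -` tube I F \<inter> space N \<in> sets N" if "finite F" for F
  proof -
    have "Z -` tube I F \<inter> space N = {\<omega> \<in> space N. \<forall>x\<in>F. case x of (p, q, a, b) \<Rightarrow>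
        \<forall>t\<in>I \<inter> {of_rat p..of_rat q}. of_rat a \<le> Z \<omega> t \<and> Z \<omega> t \<le> of_rat b}"
      using path by (auto simp: tube_def)
    also have "\<dots> \<in> sets N"
    proof (rule sets.sets_Collect_countable_All')
      show "countable F" using that by (rule countable_finite)
      show "{\<omega> \<in> space N. case x of (p, q, a, b) \<Rightarrow>
          \<forall>t\<in>I \<inter> {of_rat p..of_rat q}. of_rat a \<le> Z \<omega> t \<and> Z \<omega> t \<le> of_rat b} \<in> sets N" for x
        using box by (cases x) (simp only: prod.case)
    qed
    finally show ?thesis .
  qed
  fix U assume "U \<in> {U. openin (local_uniform_topology I) U}"
  then have "Z -` U \<inter> space N = (\<Union>F\<in>{F. finite F \<and> tube I F \<subseteq> U}. Z -` tube I F \<inter> space N)"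
    using openin_eq_Union_tubes[of I U] by blast
  also have "\<dots> \<in> sets N"
  proof (rule sets.countable_UN'')
    show "countable {F :: (rat \<times> rat \<times> rat \<times> rat) set. finite F \<and> tube I F \<subseteq> U}"
      by (rule countable_subset[OF _ countable_Collect_finite]) auto
  qed (use tube in blast)
  finally show "Z -` U \<inter> space N \<in> sets N" .
qed

section \<open>Laws of processes on the path space\<close>

definition path_map :: "real set \<Rightarrow> (real \<Rightarrow> 'a \<Rightarrow> real) \<Rightarrow> 'a \<Rightarrow> real \<Rightarrow> real" where
  "path_map I X \<omega> = (if continuous_on I (\<lambda>t. X t \<omega>) then (\<lambda>t\<in>I. X t \<omega>) else (\<lambda>t\<in>I. 0))"

lemma path_distr_eq: "path_distr I M X = distr (completion M) (borel_cont_paths I) (path_map I X)"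
  unfolding path_distr_def path_map_def ..

text \<open>The discontinuous paths lie in a null set, so they form a measurable set of the
  completion. Each coordinate of \<open>path_map\<close> is a case distinction on that set.\<close>

lemma path_map_measurable:
  assumes "real_process M X" and "I \<subseteq> {0..}" and "AE \<omega> in M. continuous_on I (\<lambda>t. X t \<omega>)"
  shows "path_map I X \<in> completion M \<rightarrow>\<^sub>M borel_cont_paths I"
proof (rule measurable_borel_cont_paths)
  show "path_map I X \<omega> \<in> cont_paths I" for \<omega>
    by (auto simp: path_map_def cont_paths_def)
  fix t assume t: "t \<in> I"
  have [measurable]: "X t \<in> borel_measurable (completion M)"
    using assms(1,2) t by (auto simp: real_process_def intro: measurable_completion)
  have [measurable]: "Measurable.pred (completion M) (\<lambda>\<omega>. \<not> continuous_on I (\<lambda>t. X t \<omega>))"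
    using assms(3) by (intro sets_completion_AE) simp
  have "(\<lambda>\<omega>. path_map I X \<omega> t) = (\<lambda>\<omega>. if \<not> continuous_on I (\<lambda>t. X t \<omega>) then 0 else X t \<omega>)"
    using t by (auto simp: path_map_def)
  then show "(\<lambda>\<omega>. path_map I X \<omega> t) \<in> borel_measurable (completion M)" by simp
qed

lemma prob_space_path_distr:
  assumes "real_process M X" and "I \<subseteq> {0..}" and "AE \<omega> in M. continuous_on I (\<lambda>t. X t \<omega>)"
  shows "prob_space (path_distr I M X)"
proof -
  interpret prob_space M using assms(1) by (simp add: real_process_def)
  have "prob_space (completion M)"
    by (rule prob_spaceI) (simp add: emeasure_space_1)
  then show ?thesis
    unfolding path_distr_eq by (rule prob_space.prob_space_distr) (rule path_map_measurable[OF assms])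
qed

text \<open>Replacing discontinuous paths by the zero path affects only a null set, so events at one
  time can be computed under \<open>M\<close>, where moments and characteristic functions are
  available.\<close>

lemma measure_path_distr_eval:
  assumes X: "real_process M X" and I: "I \<subseteq> {0..}" and C: "AE \<omega> in M. continuous_on I (\<lambda>t. X t \<omega>)"
    and t: "t \<in> I" and S: "S \<in> sets borel"
  shows "measure (path_distr I M X) {f \<in> cont_paths I. f t \<in> S} = measure M {\<omega> \<in> space M. X t \<omega> \<in> S}"
proof -
  have [measurable]: "X t \<in> borel_measurable M"
    using X I t by (auto simp: real_process_def)
  note [measurable] = S path_map_measurable[OF X I C]
  have [measurable]: "(\<lambda>f. f t) \<in> borel_measurable (borel_cont_paths I)"
    by (rule borel_cont_paths_eval[OF t])
  have ev: "{f \<in> space (borel_cont_paths I). f t \<in> S} \<in> sets (borel_cont_paths I)"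
    by measurable
  have Xm: "{\<omega> \<in> space M. X t \<omega> \<in> S} \<in> sets M" by measurable
  have "measure (path_distr I M X) {f \<in> space (borel_cont_paths I). f t \<in> S} =
      measure (completion M) (path_map I X -` {f \<in> space (borel_cont_paths I). f t \<in> S} \<inter> space (completion M))"
    unfolding path_distr_eq by (rule measure_distr[OF path_map_measurable[OF X I C] ev])
  also have "\<dots> = measure (completion M) {\<omega> \<in> space M. X t \<omega> \<in> S}"
  proof (rule measure_eq_AE)
    show "AE \<omega> in completion M. (\<omega> \<in> path_map I X -` {f \<in> space (borel_cont_paths I). f t \<in> S} \<inter>
        space (completion M)) = (\<omega> \<in> {\<omega> \<in> space M. X t \<omega> \<in> S})"
      using AE_completion[OF C] by eventually_elim (use t in \<open>auto simp: path_map_def cont_paths_def\<close>)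
    show "path_map I X -` {f \<in> space (borel_cont_paths I). f t \<in> S} \<inter> space (completion M)
        \<in> sets (completion M)"
      by (rule measurable_sets[OF path_map_measurable[OF X I C] ev])
    show "{\<omega> \<in> space M. X t \<omega> \<in> S} \<in> sets (completion M)" using Xm by simp
  qed
  also have "\<dots> = measure M {\<omega> \<in> space M. X t \<omega> \<in> S}"
    by (rule measure_completion[OF Xm])
  finally show ?thesis by simp
qed

section \<open>Singularity from asymptotic separation\<close>

text \<open>Choose indices \<open>r k\<close> at which both probabilities are below
  \<open>(1/2) ^ k\<close>. By Borel--Cantelli, almost every point for \<open>\<mu>\<close> lies in
  all but finitely many of the sets \<open>B (r k)\<close>, and almost every point for
  \<open>\<nu>\<close> in only finitely many.\<close>

lemma singular_if_asymptotically_separated: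
  fixes \<mu> \<nu> :: "'a measure"
  assumes "prob_space \<mu>" "prob_space \<nu>" and sets: "sets \<mu> = sets \<nu>"
    and B: "\<And>k. B k \<in> sets \<mu>"
    and \<mu>: "(\<lambda>k. measure \<mu> (space \<mu> - B k)) \<longlonglongrightarrow> 0" and \<nu>: "(\<lambda>k. measure \<nu> (B k)) \<longlonglongrightarrow> 0"
  shows "\<exists>A\<in>sets \<mu>. emeasure \<mu> A = 1 \<and> emeasure \<nu> A = 0"
proof -
  interpret \<mu>: prob_space \<mu> by fact
  interpret \<nu>: prob_space \<nu> by fact
  have sp: "space \<mu> = space \<nu>" by (rule sets_eq_imp_space_eq[OF sets])
  note [measurable] = B
  have [measurable]: "B k \<in> sets \<nu>" for k using B sets by simp
  have "\<exists>n. measure \<mu> (space \<mu> - B n) < (1/2) ^ k \<and> measure \<nu> (B n) < (1/2) ^ k" for k :: nat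
  proof -
    have "\<forall>\<^sub>F n in sequentially. measure \<mu> (space \<mu> - B n) < (1/2) ^ k \<and> measure \<nu> (B n) < (1/2) ^ k"
      by (intro eventually_conj order_tendstoD(2)[OF \<mu>] order_tendstoD(2)[OF \<nu>]) auto
    then show ?thesis using eventually_happens by fastforce
  qed
  then obtain r where r: "\<And>k. measure \<mu> (space \<mu> - B (r k)) < (1/2) ^ k" "\<And>k. measure \<nu> (B (r k)) < (1/2) ^ k"
    by metis
  \<comment> \<open>The lower limit of the chosen sets is the separating event.\<close>
  define A where "A = {x \<in> space \<mu>. \<forall>\<^sub>F k in sequentially. x \<in> B (r k)}"
  have A[measurable]: "A \<in> sets \<mu>" unfolding A_def eventually_sequentially by measurable
  have sm: "summable (\<lambda>k. (1/2::real) ^ k)" by (rule summable_geometric) simp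
  have "AE x in \<mu>. \<forall>\<^sub>F k in sequentially. x \<in> space \<mu> - (space \<mu> - B (r k))"
    by (rule borel_cantelli_AE1)
       (auto simp: less_top[symmetric] intro!: summable_comparison_test[OF _ sm] exI[of _ 0] less_imp_le r)
  then have "AE x in \<mu>. x \<in> A"
    by (rule AE_mp) (auto simp: A_def elim: eventually_mono)
  then have "emeasure \<mu> A = 1" using \<mu>.emeasure_eq_1_AE[OF A] by simp
  moreover have "AE x in \<nu>. \<forall>\<^sub>F k in sequentially. x \<in> space \<nu> - B (r k)"
    by (rule borel_cantelli_AE1)
       (auto simp: less_top[symmetric] intro!: summable_comparison_test[OF _ sm] exI[of _ 0] less_imp_le r)
  then have "AE x in \<nu>. x \<notin> A"
  proof eventually_elim
    fix x assume 1: "\<forall>\<^sub>F k in sequentially. x \<in> space \<nu> - B (r k)"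
    show "x \<notin> A"
    proof
      assume "x \<in> A"
      then have "\<forall>\<^sub>F k in sequentially. x \<in> B (r k)" by (simp add: A_def)
      with 1 have "\<forall>\<^sub>F k in sequentially. False" by eventually_elim auto
      then show False by simp
    qed
  qed
  then have "emeasure \<nu> A = 0"
    using A sets AE_iff_measurable[of A \<nu> "\<lambda>x. x \<notin> A"] sets.sets_into_space[OF A] sp by auto
  ultimately show ?thesis using A by blast
qed

section \<open>Characteristic functions of dilatively stable processes\<close>

abbreviation char_of :: "'a measure \<Rightarrow> ('a \<Rightarrow> real) \<Rightarrow> real \<Rightarrow> complex" where
  "char_of M X \<equiv> char (distr M borel X)"

text \<open>Only the value at \<open>t\<close> of the argument of \<open>joint_char\<close> matters
  here, so a constant function can stand for the real argument \<open>s\<close>.\<close>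

lemma joint_char_singleton:
  assumes "X t \<in> borel_measurable M"
  shows "joint_char {t} (fin_dim_distr M X {t}) (\<lambda>_. s) = char_of M (X t) s"
proof -
  note [measurable] = assms
  have [measurable]: "(\<lambda>\<omega>. \<lambda>t\<in>{t}. X t \<omega>) \<in> M \<rightarrow>\<^sub>M PiM {t} (\<lambda>_. borel)"
    by (rule measurable_restrict) (use assms in simp)
  have "joint_char {t} (fin_dim_distr M X {t}) (\<lambda>_. s) =
      (CLINT x|distr M (PiM {t} (\<lambda>_. borel)) (\<lambda>\<omega>. \<lambda>t\<in>{t}. X t \<omega>). iexp (s * x t))"
    unfolding joint_char_def fin_dim_distr_def by simp
  also have "\<dots> = (CLINT \<omega>|M. iexp (s * X t \<omega>))"
    by (subst integral_distr) auto
  also have "\<dots> = char_of M (X t) s"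
    unfolding char_def by (subst integral_distr) auto
  finally show ?thesis .
qed

lemma char_of_scale:
  assumes "X \<in> borel_measurable M"
  shows "char_of M (\<lambda>\<omega>. c * X \<omega>) s = char_of M X (s * c)"
proof -
  note [measurable] = assms
  show ?thesis
    unfolding char_def by (subst (1 2) integral_distr) (auto simp: mult_ac)
qed

lemma dilatively_stable_measurable:
  assumes "dilatively_stable M X \<alpha> \<delta>" "t \<ge> 0"
  shows "prob_space M" "X t \<in> borel_measurable M"
  using assms by (auto simp: dilatively_stable_def real_process_def)

text \<open>The distinguished logarithm \<open>\<psi>\<close> enters only through its real part: the
  modulus of \<open>exp (c * \<psi>)\<close> is that of \<open>exp \<psi>\<close> to the power
  \<open>c\<close>. With moduli, no branch of the logarithm has to be controlled.\<close>

lemma dilatively_stable_char_norm: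
  assumes X: "dilatively_stable M X \<alpha> \<delta>" and t: "t > 0"
  shows "cmod (char_of M (X t) s) =
    cmod (char_of M (X 1) (s * t powr (\<alpha> - \<delta> / 2))) powr (t powr \<delta>)"
proof -
  obtain N :: "(real \<Rightarrow> real) measure" and Y where
    Y: "is_conv_power_process (t powr \<delta>) M X N Y"
    and eq: "fd_equal M (\<lambda>u. X (t * u)) N (\<lambda>u \<omega>. t powr (\<alpha> - \<delta> / 2) * Y u \<omega>)"
    using X t unfolding dilatively_stable_def by blast
  have J: "finite {1::real} \<and> {1::real} \<subseteq> {0..}" by simp
  have [measurable]: "Y 1 \<in> borel_measurable N" "X 1 \<in> borel_measurable M" "X t \<in> borel_measurable M"
    using Y dilatively_stable_measurable(2)[OF X] t by (auto simp: is_conv_power_process_def real_process_def)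
  obtain \<psi> where
    \<psi>: "\<And>\<theta>. joint_char {1} (fin_dim_distr M X {1}) \<theta> = exp (\<psi> \<theta>)"
       "\<And>\<theta>. joint_char {1} (fin_dim_distr N Y {1}) \<theta> = exp (of_real (t powr \<delta>) * \<psi> \<theta>)"
    using Y J unfolding is_conv_power_process_def is_conv_power_def by blast
  have powr: "cmod (char_of N (Y 1) u) = cmod (char_of M (X 1) u) powr (t powr \<delta>)" for u
  proof -
    have "cmod (char_of M (X 1) u) = exp (Re (\<psi> (\<lambda>_. u)))"
      using \<psi>(1)[of "\<lambda>_. u"] by (simp add: joint_char_singleton norm_exp_eq_Re)
    moreover have "cmod (char_of N (Y 1) u) = exp (t powr \<delta> * Re (\<psi> (\<lambda>_. u)))"
      using \<psi>(2)[of "\<lambda>_. u"] by (simp add: joint_char_singleton norm_exp_eq_Re)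
    ultimately show ?thesis by (simp add: powr_def)
  qed
  have "char_of M (X (t * 1)) s = char_of N (\<lambda>\<omega>. t powr (\<alpha> - \<delta> / 2) * Y 1 \<omega>) s"
  proof -
    have "fin_dim_distr M (\<lambda>u. X (t * u)) {1} = fin_dim_distr N (\<lambda>u \<omega>. t powr (\<alpha> - \<delta> / 2) * Y u \<omega>) {1}"
      using eq J unfolding fd_equal_def by blast
    then show ?thesis
      using joint_char_singleton[of "\<lambda>u. X (t * u)" 1 M s]
        joint_char_singleton[of "\<lambda>u \<omega>. t powr (\<alpha> - \<delta> / 2) * Y u \<omega>" 1 N s] by simp
  qed
  then show ?thesis by (simp add: char_of_scale powr)
qed

section \<open>Second moments from the characteristic function\<close>

text \<open>With mean zero and a finite third absolute moment, the characteristic function is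
  \<open>1 - s\<^sup>2 * v / 2\<close> up to an error of order \<open>\<bar>s\<bar> ^ 3\<close>. The
  modulus inherits this expansion, and elementary bounds on \<open>ln\<close> carry it to the
  logarithm.\<close>

lemma ln_norm_char_second_order:
  assumes "prob_space M" and X: "X \<in> borel_measurable M"
    and int: "\<And>k::nat. integrable M (\<lambda>\<omega>. X \<omega> ^ k)" and mean: "(\<integral>\<omega>. X \<omega> \<partial>M) = 0"
  shows "((\<lambda>s. ln (cmod (char_of M X s)) / s\<^sup>2) \<longlongrightarrow> - (\<integral>\<omega>. (X \<omega>)\<^sup>2 \<partial>M) / 2) (at 0)"
    and "((\<lambda>s. cmod (char_of M X s)) \<longlongrightarrow> 1) (at 0)"
proof -
  interpret M: prob_space M by fact
  note [measurable] = X
  interpret D: real_distribution "distr M borel X"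
    by (rule M.real_distribution_distr) simp
  define v where "v = (\<integral>\<omega>. (X \<omega>)\<^sup>2 \<partial>M)"
  define K where "K = (\<integral>\<omega>. \<bar>X \<omega>\<bar> ^ 3 \<partial>M) / 6"
  define \<phi> where "\<phi> s = cmod (char_of M X s)" for s
  have i1: "integrable M X" using int[of 1] by simp
  have i3: "integrable M (\<lambda>\<omega>. \<bar>X \<omega>\<bar> ^ 3)"
    using integrable_abs[OF int[of 3]] by (simp add: power_abs)
  \<comment> \<open>The reverse triangle inequality compares moduli, hence the inner bars; they
    disappear near 0, where \<open>1 - s\<^sup>2 * v / 2\<close> is positive.\<close>
  have approx: "\<bar>\<phi> s - \<bar>1 - s\<^sup>2 * v / 2\<bar>\<bar> \<le> K * \<bar>s\<bar> ^ 3" for s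
  proof -
    have "cmod (char_of M X s - (1 - s\<^sup>2 * v / 2)) \<le>
        (s\<^sup>2 / 6) * (\<integral>\<omega>. min (6 * (X \<omega>)\<^sup>2) (\<bar>s\<bar> * \<bar>X \<omega>\<bar> ^ 3) \<partial>M)"
      by (rule M.char_approx3') (use i1 int[of 2] mean in \<open>simp_all add: v_def\<close>)
    also have "\<dots> \<le> (s\<^sup>2 / 6) * (\<integral>\<omega>. \<bar>s\<bar> * \<bar>X \<omega>\<bar> ^ 3 \<partial>M)"
      by (intro mult_left_mono integral_mono' integrable_mult_right i3) auto
    also have "\<dots> = K * \<bar>s\<bar> ^ 3"
      by (simp add: K_def power2_eq_square power3_eq_cube)
    finally have "cmod (char_of M X s - complex_of_real (1 - s\<^sup>2 * v / 2)) \<le> K * \<bar>s\<bar> ^ 3" by simp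
    moreover have "\<bar>\<phi> s - \<bar>1 - s\<^sup>2 * v / 2\<bar>\<bar> \<le> cmod (char_of M X s - complex_of_real (1 - s\<^sup>2 * v / 2))"
      unfolding \<phi>_def using norm_triangle_ineq3[of "char_of M X s" "complex_of_real (1 - s\<^sup>2 * v / 2)"]
      by (simp only: norm_of_real)
    ultimately show ?thesis by linarith
  qed
  have lim1: "(\<phi> \<longlongrightarrow> 1) (at 0)"
  proof -
    have "isCont (\<lambda>s. cmod (char_of M X s)) 0"
      by (intro isCont_norm D.isCont_char)
    then show ?thesis unfolding \<phi>_def isCont_def by (simp add: D.char_zero)
  qed
  then show "((\<lambda>s. cmod (char_of M X s)) \<longlongrightarrow> 1) (at 0)" unfolding \<phi>_def .
  have q: "((\<lambda>s. (\<phi> s - 1) / s\<^sup>2) \<longlongrightarrow> - v / 2) (at 0)"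
  proof (rule LIM_zero_cancel, rule Lim_null_comparison)
    have "((\<lambda>s. 1 - s\<^sup>2 * v / 2) \<longlongrightarrow> 1 - 0\<^sup>2 * v / 2) (at 0)" by (intro tendsto_intros) simp
    then have "\<forall>\<^sub>F s in at 0. 1 - s\<^sup>2 * v / 2 > 0"
      by (intro order_tendstoD(1)[where y = 1]) auto
    moreover have "\<forall>\<^sub>F s::real in at 0. s \<noteq> 0" by (simp add: eventually_at_filter)
    ultimately show "\<forall>\<^sub>F s in at 0. norm ((\<phi> s - 1) / s\<^sup>2 - - v / 2) \<le> K * \<bar>s\<bar>"
    proof eventually_elim
      fix s :: real assume s: "1 - s\<^sup>2 * v / 2 > 0" "s \<noteq> 0"
      have "(\<phi> s - 1) / s\<^sup>2 - - v / 2 = (\<phi> s - (1 - s\<^sup>2 * v / 2)) / s\<^sup>2"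
        using s(2) by (simp add: field_simps)
      also have "norm \<dots> = \<bar>\<phi> s - \<bar>1 - s\<^sup>2 * v / 2\<bar>\<bar> / s\<^sup>2" using s(1) by simp
      also have "\<dots> \<le> K * \<bar>s\<bar> ^ 3 / s\<^sup>2" by (intro divide_right_mono approx) simp
      also have "\<dots> = K * \<bar>s\<bar>"
        using s(2) by (simp add: power3_eq_cube power2_eq_square field_simps)
      finally show "norm ((\<phi> s - 1) / s\<^sup>2 - - v / 2) \<le> K * \<bar>s\<bar>" .
    qed
    have "((\<lambda>s. K * \<bar>s\<bar>) \<longlongrightarrow> K * \<bar>0\<bar>) (at 0)" by (intro tendsto_intros)
    then show "((\<lambda>s. K * \<bar>s\<bar>) \<longlongrightarrow> 0) (at 0)" by simp
  qed
  have q': "((\<lambda>s. ((\<phi> s - 1) / s\<^sup>2) / \<phi> s) \<longlongrightarrow> - v / 2) (at 0)"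
    using tendsto_divide[OF q lim1] by simp
  have pos: "\<forall>\<^sub>F s in at 0. \<phi> s > 0"
    by (rule order_tendstoD(1)[OF lim1]) simp
  have "((\<lambda>s. ln (\<phi> s) / s\<^sup>2) \<longlongrightarrow> - v / 2) (at 0)"
  \<comment> \<open>The sandwich is \<open>1 - 1 / x \<le> ln x \<le> x - 1\<close> at
    \<open>x = \<phi> s\<close>, divided by \<open>s\<^sup>2\<close>.\<close>
  proof (rule tendsto_sandwich[OF _ _ q' q])
    show "\<forall>\<^sub>F s in at 0. ln (\<phi> s) / s\<^sup>2 \<le> (\<phi> s - 1) / s\<^sup>2"
      using pos by eventually_elim (intro divide_right_mono ln_le_minus_one, auto)
    show "\<forall>\<^sub>F s in at 0. (\<phi> s - 1) / s\<^sup>2 / \<phi> s \<le> ln (\<phi> s) / s\<^sup>2"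
      using pos
    proof eventually_elim
      fix s assume p: "\<phi> s > 0"
      have "ln (inverse (\<phi> s)) \<le> inverse (\<phi> s) - 1" using p by (intro ln_le_minus_one) simp
      then have "1 - inverse (\<phi> s) \<le> ln (\<phi> s)" by (simp add: ln_inverse)
      then have "(\<phi> s - 1) / \<phi> s \<le> ln (\<phi> s)" using p by (simp add: divide_simps)
      then have "((\<phi> s - 1) / \<phi> s) / s\<^sup>2 \<le> ln (\<phi> s) / s\<^sup>2" by (rule divide_right_mono) simp
      then show "(\<phi> s - 1) / s\<^sup>2 / \<phi> s \<le> ln (\<phi> s) / s\<^sup>2" by (simp add: mult.commute)
    qed
  qed
  then show "((\<lambda>s. ln (cmod (char_of M X s)) / s\<^sup>2) \<longlongrightarrow> - (\<integral>\<omega>. (X \<omega>)\<^sup>2 \<partial>M) / 2) (at 0)"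
    unfolding \<phi>_def v_def .
qed

lemma dilatively_stable_ln_char:
  assumes X: "dilatively_stable M X \<alpha> \<delta>" and mean: "\<forall>t\<ge>0. (\<integral>\<omega>. X t \<omega> \<partial>M) = 0" and t: "t \<ge> 0"
  shows "((\<lambda>s. ln (cmod (char_of M (X t) s)) / s\<^sup>2) \<longlongrightarrow> - (\<integral>\<omega>. (X t \<omega>)\<^sup>2 \<partial>M) / 2) (at 0)"
    and "((\<lambda>s. cmod (char_of M (X t) s)) \<longlongrightarrow> 1) (at 0)"
proof -
  have "\<And>k. integrable M (\<lambda>\<omega>. X t \<omega> ^ k)" "(\<integral>\<omega>. X t \<omega> \<partial>M) = 0"
    using X mean t by (auto simp: dilatively_stable_def)
  note ln_norm_char_second_order[OF dilatively_stable_measurable[OF X t] this]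
  then show "((\<lambda>s. ln (cmod (char_of M (X t) s)) / s\<^sup>2) \<longlongrightarrow> - (\<integral>\<omega>. (X t \<omega>)\<^sup>2 \<partial>M) / 2) (at 0)"
    and "((\<lambda>s. cmod (char_of M (X t) s)) \<longlongrightarrow> 1) (at 0)" by blast+
qed

text \<open>The second moment is read off from \<open>ln (cmod \<dots>) / s\<^sup>2\<close> at 0 on
  both sides of the scaling identity, so moments of the convolution power never have to be
  computed.\<close>

lemma dilatively_stable_second_moment:
  assumes X: "dilatively_stable M X \<alpha> \<delta>" and mean: "\<forall>t\<ge>0. (\<integral>\<omega>. X t \<omega> \<partial>M) = 0" and t: "t > 0"
  shows "(\<integral>\<omega>. (X t \<omega>)\<^sup>2 \<partial>M) = t powr (2 * \<alpha>) * (\<integral>\<omega>. (X 1 \<omega>)\<^sup>2 \<partial>M)"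
proof -
  define c where "c = t powr (\<alpha> - \<delta> / 2)"
  have c: "c > 0" using t by (simp add: c_def)
  note lim1 = dilatively_stable_ln_char(1)[OF X mean zero_le_one]
  note limt = dilatively_stable_ln_char(1)[OF X mean less_imp_le[OF t]]
  have fl: "filterlim (\<lambda>s. s * c) (at 0) (at 0)"
  proof (rule filterlim_atI)
    have "((\<lambda>s. s * c) \<longlongrightarrow> 0 * c) (at 0)" by (intro tendsto_intros)
    then show "((\<lambda>s. s * c) \<longlongrightarrow> 0) (at 0)" by simp
    show "\<forall>\<^sub>F s in at 0. s * c \<noteq> 0" using c by (simp add: eventually_at_filter)
  qed
  have "((\<lambda>s. ln (cmod (char_of M (X 1) (s * c))) / (s * c)\<^sup>2) \<longlongrightarrow> - (\<integral>\<omega>. (X 1 \<omega>)\<^sup>2 \<partial>M) / 2) (at 0)"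
    by (rule filterlim_compose[OF lim1 fl])
  then have "((\<lambda>s. (t powr \<delta> * c\<^sup>2) * (ln (cmod (char_of M (X 1) (s * c))) / (s * c)\<^sup>2)) \<longlongrightarrow>
      (t powr \<delta> * c\<^sup>2) * (- (\<integral>\<omega>. (X 1 \<omega>)\<^sup>2 \<partial>M) / 2)) (at 0)"
    by (rule tendsto_mult_left)
  \<comment> \<open>The logarithm turns the outer power \<open>t powr \<delta>\<close> into a
    factor, and \<open>c\<^sup>2\<close> compensates for the rescaled denominator.\<close>
  moreover have "(\<lambda>s. (t powr \<delta> * c\<^sup>2) * (ln (cmod (char_of M (X 1) (s * c))) / (s * c)\<^sup>2)) =
      (\<lambda>s. ln (cmod (char_of M (X t) s)) / s\<^sup>2)"
    using c by (simp add: fun_eq_iff dilatively_stable_char_norm[OF X t] c_def[symmetric] ln_powr power_mult_distrib)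
  ultimately have "(t powr \<delta> * c\<^sup>2) * (- (\<integral>\<omega>. (X 1 \<omega>)\<^sup>2 \<partial>M) / 2) = - (\<integral>\<omega>. (X t \<omega>)\<^sup>2 \<partial>M) / 2"
    using tendsto_unique[OF _ _ limt] by simp
  moreover have "t powr \<delta> * c\<^sup>2 = t powr (2 * \<alpha>)"
    using t by (simp add: c_def power2_eq_square flip: powr_add)
  ultimately show ?thesis by simp
qed

text \<open>With zero second moment the law of \<open>X 1\<close> would be the point mass at 0,
  which counts as Gaussian and is therefore excluded.\<close>

lemma dilatively_stable_variance_pos:
  assumes X: "dilatively_stable M X \<alpha> \<delta>"
  shows "(\<integral>\<omega>. (X 1 \<omega>)\<^sup>2 \<partial>M) > 0"
proof (rule ccontr)
  assume "\<not> ?thesis"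
  then have 0: "(\<integral>\<omega>. (X 1 \<omega>)\<^sup>2 \<partial>M) = 0"
    by (simp add: antisym not_less)
  interpret prob_space M using dilatively_stable_measurable(1)[OF X, of 1] by simp
  have [measurable]: "X 1 \<in> borel_measurable M"
    using dilatively_stable_measurable(2)[OF X, of 1] by simp
  have "integrable M (\<lambda>\<omega>. (X 1 \<omega>)\<^sup>2)" using X by (auto simp: dilatively_stable_def)
  then have "AE \<omega> in M. (X 1 \<omega>)\<^sup>2 = 0"
    using 0 by (subst (asm) integral_nonneg_eq_0_iff_AE) auto
  then have "AE \<omega> in M. X 1 \<omega> = 0" by simp
  then have "distr M borel (X 1) = distr M borel (\<lambda>_. 0)"
    by (intro distr_cong_AE) auto
  also have "\<dots> = return borel 0" by (rule distr_const) simp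
  finally have "gaussian_law (distr M borel (X 1))" by (auto simp: gaussian_law_def)
  then show False using X by (simp add: dilatively_stable_def)
qed

text \<open>The integrand of the jump part has real part \<open>cos (s * x) - 1 \<le> 0\<close>, so
  jumps can only lower the modulus and the Gaussian factor alone bounds it.\<close>

lemma has_gaussian_component_char_bound:
  assumes "has_gaussian_component \<mu>"
  obtains v where "v > 0" "\<And>s. cmod (char \<mu> s) \<le> exp (- v * s\<^sup>2)"
proof -
  obtain b v \<nu> where v: "v > 0" and *: "\<And>s. char \<mu> s =
        exp (\<i> * of_real (b * s) - of_real (v * s\<^sup>2 / 2) +
          (CLINT x|\<nu>. iexp (s * x) - 1 - \<i> * of_real (s * x * indicator {-1..1} x)))"
    using assms by (auto simp: has_gaussian_component_def levy_khintchine_def)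
  have "cmod (char \<mu> s) \<le> exp (- (v / 2) * s\<^sup>2)" for s
  proof -
    define f where "f x = iexp (s * x) - 1 - \<i> * of_real (s * x * indicator {-1..1} x)" for x
    have "Re (integral\<^sup>L \<nu> f) \<le> 0"
    proof (cases "integrable \<nu> f")
      case True
      then have "Re (integral\<^sup>L \<nu> f) = (\<integral>x. Re (f x) \<partial>\<nu>)" by simp
      also have "\<dots> \<le> (\<integral>x. 0 \<partial>\<nu>)"
        using integrable_Re[OF True] by (intro integral_mono) (auto simp: f_def Re_exp)
      finally show ?thesis by simp
    qed (simp add: not_integrable_integral_eq) \<comment> \<open>the junk value \<open>0\<close> still satisfies the bound\<close>
    moreover have "cmod (char \<mu> s) = exp (- (v / 2) * s\<^sup>2 + Re (integral\<^sup>L \<nu> f))"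
      unfolding * f_def[symmetric] by (simp add: norm_exp_eq_Re)
    ultimately show ?thesis by simp
  qed
  then show thesis using v that[of "v / 2"] by simp
qed

text \<open>A consequence of the second-order behaviour at 0 together with positive variance. It
  replaces the global bound when no Gaussian component is assumed.\<close>

lemma char_gaussian_bound_near_0:
  assumes X: "dilatively_stable M X \<alpha> \<delta>" and mean: "\<forall>t\<ge>0. (\<integral>\<omega>. X t \<omega> \<partial>M) = 0"
  obtains v r where "v > 0" "r > 0" "\<And>s. \<bar>s\<bar> < r \<Longrightarrow> cmod (char_of M (X 1) s) \<le> exp (- v * s\<^sup>2)"
proof -
  \<comment> \<open>The limit of \<open>ln (cmod \<dots>) / s\<^sup>2\<close> is then
    \<open>- 2 * v\<close>, strictly below \<open>- v\<close>.\<close>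
  define v where "v = (\<integral>\<omega>. (X 1 \<omega>)\<^sup>2 \<partial>M) / 4"
  have v: "v > 0" using dilatively_stable_variance_pos[OF X] by (simp add: v_def)
  note so = dilatively_stable_ln_char[OF X mean zero_le_one]
  interpret prob_space M using dilatively_stable_measurable(1)[OF X, of 1] by simp
  interpret D: real_distribution "distr M borel (X 1)"
    by (rule real_distribution_distr) (use dilatively_stable_measurable(2)[OF X, of 1] in simp)
  have "\<forall>\<^sub>F s in at 0. ln (cmod (char_of M (X 1) s)) / s\<^sup>2 < - v"
    using mean v by (intro order_tendstoD(2)[OF so(1)]) (auto simp: v_def)
  moreover have "\<forall>\<^sub>F s in at 0. 0 < cmod (char_of M (X 1) s)"
    using mean by (intro order_tendstoD(1)[OF so(2)]) auto
  ultimately have "\<forall>\<^sub>F s in at 0. cmod (char_of M (X 1) s) \<le> exp (- v * s\<^sup>2)"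
    using eventually_neq_at_within[of 0]
  proof eventually_elim
    fix s :: real assume s: "ln (cmod (char_of M (X 1) s)) / s\<^sup>2 < - v" "0 < cmod (char_of M (X 1) s)" "s \<noteq> 0"
    have "ln (cmod (char_of M (X 1) s)) \<le> - v * s\<^sup>2"
      using s by (simp add: divide_less_eq)
    then show "cmod (char_of M (X 1) s) \<le> exp (- v * s\<^sup>2)"
      using s(2) by (metis exp_le_cancel_iff exp_ln)
  qed
  then obtain r where r: "r > 0" "\<And>s. s \<noteq> 0 \<Longrightarrow> \<bar>s\<bar> < r \<Longrightarrow> cmod (char_of M (X 1) s) \<le> exp (- v * s\<^sup>2)"
    unfolding eventually_at by (auto simp: dist_real_def)
  have "cmod (char_of M (X 1) s) \<le> exp (- v * s\<^sup>2)" if "\<bar>s\<bar> < r" for s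
    using r(2)[of s] that by (cases "s = 0") (auto simp: D.char_zero)
  then show thesis using that v r(1) by blast
qed

section \<open>Anti-concentration\<close>

text \<open>
  Gaussian smoothing: \<open>exp (- (x / \<epsilon>)\<^sup>2 / 2)\<close> dominates the indicator of \<open>{-\<epsilon>..\<epsilon>}\<close> up to the factor
  \<open>exp (1/2)\<close>, and it is the standard normal characteristic function at \<open>x / \<epsilon>\<close>, so Fubini applies.
\<close>

lemma (in real_distribution) prob_abs_le_char_bound:
  assumes \<epsilon>: "\<epsilon> > 0"
  shows "prob {x. \<bar>x\<bar> \<le> \<epsilon>} \<le>
    exp (1/2) * (\<integral>s. cmod (char M (s / \<epsilon>)) \<partial>std_normal_distribution)"
proof -
  let ?N = std_normal_distribution
  interpret N: real_distribution ?N by (rule real_dist_normal_dist)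
  interpret P: pair_prob_space M ?N ..
  have "(CLINT x|M. CLINT s|?N. iexp (x / \<epsilon> * s)) = (CLINT s|?N. CLINT x|M. iexp (x / \<epsilon> * s))"
    by (rule P.Fubini_integral[symmetric], rule P.integrable_const_bound[where B = 1]) auto
  also have "\<dots> = (CLINT s|?N. char M (s / \<epsilon>))"
    unfolding char_def by (simp add: mult_ac)
  finally have eq: "(CLINT x|M. char ?N (x / \<epsilon>)) = (CLINT s|?N. char M (s / \<epsilon>))"
    by (simp add: char_def)
  have int: "integrable M (\<lambda>x. exp (- (x / \<epsilon>)\<^sup>2 / 2))"
    by (rule integrable_const_bound[where B = 1]) auto
  have "exp (- 1/2) * prob {x. \<bar>x\<bar> \<le> \<epsilon>} = (\<integral>x. exp (- 1/2) * indicator {x. \<bar>x\<bar> \<le> \<epsilon>} x \<partial>M)"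
    by simp
  also have "\<dots> \<le> (\<integral>x. exp (- (x / \<epsilon>)\<^sup>2 / 2) \<partial>M)"
  proof (rule integral_mono[OF _ int])
    fix x
    show "exp (- 1/2) * indicator {x. \<bar>x\<bar> \<le> \<epsilon>} x \<le> exp (- (x / \<epsilon>)\<^sup>2 / 2)"
    proof (cases "\<bar>x\<bar> \<le> \<epsilon>")
      case True
      then have "(x / \<epsilon>)\<^sup>2 \<le> 1" using \<epsilon> by (simp add: abs_square_le_1)
      then show ?thesis using True by simp
    qed simp
  qed (auto intro!: integrable_mult_right simp: less_top[symmetric])
  also have "\<dots> = cmod (CLINT x|M. char ?N (x / \<epsilon>))"
  proof -
    have "(CLINT x|M. char ?N (x / \<epsilon>)) = of_real (\<integral>x. exp (- (x / \<epsilon>)\<^sup>2 / 2) \<partial>M)"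
      unfolding char_std_normal_distribution by (rule integral_complex_of_real)
    moreover have "(\<integral>x. exp (- (x / \<epsilon>)\<^sup>2 / 2) \<partial>M) \<ge> 0" by (rule integral_nonneg_AE) simp
    ultimately show ?thesis by (simp only: norm_of_real abs_of_nonneg)
  qed
  also have "\<dots> \<le> (\<integral>s. cmod (char M (s / \<epsilon>)) \<partial>?N)"
    unfolding eq by (rule integral_norm_bound)
  finally have "exp (1/2) * (exp (- 1/2) * prob {x. \<bar>x\<bar> \<le> \<epsilon>}) \<le>
      exp (1/2) * (\<integral>s. cmod (char M (s / \<epsilon>)) \<partial>?N)"
    by (intro mult_left_mono) simp_all
  then show ?thesis by (simp flip: exp_add mult.assoc)
qed

text \<open>Fix a scale \<open>d\<close> at which the integral of the Gaussian bound is small, and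
  let \<open>k\<close> grow until \<open>\<epsilon> k < d\<close>. The bound holds eventually for
  each single \<open>s\<close>, not uniformly, so dominated convergence in \<open>k\<close> is
  used.\<close>

lemma no_concentration_at_0:
  fixes \<mu> :: "nat \<Rightarrow> real measure"
  assumes \<mu>: "\<And>k. real_distribution (\<mu> k)" and v: "v > 0"
    and bound: "\<And>s. \<forall>\<^sub>F k in sequentially. cmod (char (\<mu> k) s) \<le> exp (- v * s\<^sup>2)"
    and \<epsilon>: "\<epsilon> \<longlonglongrightarrow> 0"
  shows "(\<lambda>k. measure (\<mu> k) {x. \<bar>x\<bar> \<le> \<epsilon> k}) \<longlonglongrightarrow> 0"
proof (rule order_tendstoI)
  let ?N = std_normal_distribution
  interpret N: real_distribution ?N by (rule real_dist_normal_dist)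
  fix e :: real assume "0 < e"
  have ne: "AE s in ?N. s \<noteq> 0"
    using AE_lborel_singleton[of "0::real"] by (subst AE_density) auto
  \<comment> \<open>As the scale \<open>1 / Suc n\<close> shrinks, the integrand tends to 0 except
    at \<open>s = 0\<close>, which is a null set.\<close>
  have "(\<lambda>n. \<integral>s. exp (- v * (s / (1 / real (Suc n)))\<^sup>2) \<partial>?N) \<longlonglongrightarrow> (\<integral>s. 0 \<partial>?N)"
  proof (rule integral_dominated_convergence[where w = "\<lambda>_. 1"])
    show "AE s in ?N. (\<lambda>n. exp (- v * (s / (1 / real (Suc n)))\<^sup>2)) \<longlonglongrightarrow> 0"
      using ne
    proof eventually_elim
      fix s :: real assume s: "s \<noteq> 0"
      have "v * s\<^sup>2 > 0" using v s by simp
      then have "filterlim (\<lambda>n. v * s\<^sup>2 * real n) at_top sequentially"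
        by (intro filterlim_tendsto_pos_mult_at_top[OF tendsto_const _ filterlim_real_sequentially])
      then have lim: "(\<lambda>n. exp (- (v * s\<^sup>2 * real n))) \<longlonglongrightarrow> 0"
        by (intro filterlim_compose[OF exp_at_bot]) (simp add: filterlim_uminus_at_bot)
      show "(\<lambda>n. exp (- v * (s / (1 / real (Suc n)))\<^sup>2)) \<longlonglongrightarrow> 0"
      proof (rule tendsto_sandwich[OF _ _ tendsto_const lim])
        have "real n \<le> (real (Suc n))\<^sup>2" for n by (simp add: power2_eq_square algebra_simps)
        then have "v * s\<^sup>2 * real n \<le> v * s\<^sup>2 * (real (Suc n))\<^sup>2" for n
          using v by (intro mult_left_mono) auto
        then show "\<forall>\<^sub>F n in sequentially. exp (- v * (s / (1 / real (Suc n)))\<^sup>2) \<le> exp (- (v * s\<^sup>2 * real n))"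
          by (intro always_eventually) (simp add: power_mult_distrib mult.assoc)
      qed simp
    qed
  qed (use v in auto)
  then have "(\<lambda>n. exp (1/2) * (\<integral>s. exp (- v * (s / (1 / real (Suc n)))\<^sup>2) \<partial>?N)) \<longlonglongrightarrow> exp (1/2) * 0"
    by (intro tendsto_mult_left) simp
  from order_tendstoD(2)[OF this, of e] \<open>0 < e\<close>
  have "\<forall>\<^sub>F n in sequentially. exp (1/2) * (\<integral>s. exp (- v * (s / (1 / real (Suc n)))\<^sup>2) \<partial>?N) < e" by simp
  then obtain n where n: "exp (1/2) * (\<integral>s. exp (- v * (s / (1 / real (Suc n)))\<^sup>2) \<partial>?N) < e"
    using eventually_happens by fastforce
  define d where "d = 1 / real (Suc n)"
  have d: "d > 0" by (simp add: d_def)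
  \<comment> \<open>The moduli themselves need not converge in \<open>k\<close>; their maximum with
    the bound is eventually equal to the bound for each \<open>s\<close>.\<close>
  define h where "h k s = max (cmod (char (\<mu> k) (s / d))) (exp (- v * (s / d)\<^sup>2))" for k s
  have char1: "cmod (char (\<mu> k) s) \<le> 1" for k s by (rule real_distribution.cmod_char_le_1[OF \<mu>])
  have [measurable]: "char (\<mu> k) \<in> borel_measurable borel" for k
    by (rule real_distribution.char_measurable[OF \<mu>])
  have [measurable]: "h k \<in> borel_measurable ?N" for k
    unfolding h_def by measurable
  have h1: "\<bar>h k s\<bar> \<le> 1" for k s
    using char1[of k "s / d"] v by (auto simp: h_def abs_of_nonneg le_max_iff_disj)
  have "(\<lambda>k. \<integral>s. h k s \<partial>?N) \<longlonglongrightarrow> (\<integral>s. exp (- v * (s / d)\<^sup>2) \<partial>?N)"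
  proof (rule integral_dominated_convergence[where w = "\<lambda>_. 1"])
    show "AE s in ?N. (\<lambda>k. h k s) \<longlonglongrightarrow> exp (- v * (s / d)\<^sup>2)"
    proof (rule AE_I2, rule tendsto_eventually)
      show "\<forall>\<^sub>F k in sequentially. h k s = exp (- v * (s / d)\<^sup>2)" for s
        using bound[of "s / d"] by eventually_elim (simp add: h_def)
    qed
  qed (use h1 in auto)
  then have "(\<lambda>k. exp (1/2) * (\<integral>s. h k s \<partial>?N)) \<longlonglongrightarrow> exp (1/2) * (\<integral>s. exp (- v * (s / d)\<^sup>2) \<partial>?N)"
    by (rule tendsto_mult_left)
  then have "\<forall>\<^sub>F k in sequentially. exp (1/2) * (\<integral>s. h k s \<partial>?N) < e"
    using n by (intro order_tendstoD(2)) (simp_all add: d_def)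
  moreover have "\<forall>\<^sub>F k in sequentially. \<epsilon> k < d"
    using \<epsilon> d by (rule order_tendstoD(2))
  ultimately show "\<forall>\<^sub>F k in sequentially. measure (\<mu> k) {x. \<bar>x\<bar> \<le> \<epsilon> k} < e"
  proof eventually_elim
    fix k assume k: "exp (1/2) * (\<integral>s. h k s \<partial>?N) < e" "\<epsilon> k < d"
    interpret K: real_distribution "\<mu> k" by (rule \<mu>)
    have "K.prob {x. \<bar>x\<bar> \<le> \<epsilon> k} \<le> K.prob {x. \<bar>x\<bar> \<le> d}"
      by (rule K.finite_measure_mono) (use k(2) in auto)
    also have "\<dots> \<le> exp (1/2) * (\<integral>s. cmod (char (\<mu> k) (s / d)) \<partial>?N)"
      by (rule K.prob_abs_le_char_bound[OF d])
    also have "\<dots> \<le> exp (1/2) * (\<integral>s. h k s \<partial>?N)"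
    proof (intro mult_left_mono integral_mono)
      show "integrable ?N (\<lambda>s. cmod (char (\<mu> k) (s / d)))"
        by (rule N.integrable_const_bound[where B = 1]) (auto simp: char1)
      show "integrable ?N (h k)"
        by (rule N.integrable_const_bound[where B = 1]) (auto simp: h1)
      show "cmod (char (\<mu> k) (s / d)) \<le> h k s" for s by (simp add: h_def)
    qed simp
    finally show "K.prob {x. \<bar>x\<bar> \<le> \<epsilon> k} < e" using k(1) by simp
  qed
next
  fix e :: real assume "e < 0"
  then show "\<forall>\<^sub>F k in sequentially. e < measure (\<mu> k) {x. \<bar>x\<bar> \<le> \<epsilon> k}"
    by (intro always_eventually allI) (rule less_le_trans[OF _ measure_nonneg])
qed

section \<open>Large and small values along a sequence of times\<close>

text \<open>Chebyshev's inequality at level \<open>t k powr \<beta>\<close>, with the second moment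
  proportional to \<open>t k powr (2 * \<alpha>)\<close>. The limit hypothesis covers times tending
  to 0 and times tending to infinity alike.\<close>

lemma dilatively_stable_prob_large:
  fixes t :: "nat \<Rightarrow> real"
  assumes X: "dilatively_stable M X \<alpha> \<delta>" and mean: "\<forall>t\<ge>0. (\<integral>\<omega>. X t \<omega> \<partial>M) = 0"
    and t: "\<And>k. t k > 0" and lim: "(\<lambda>k. t k powr (\<alpha> - \<beta>)) \<longlonglongrightarrow> 0"
  shows "(\<lambda>k. measure M {\<omega> \<in> space M. t k powr \<beta> < \<bar>X (t k) \<omega>\<bar>}) \<longlonglongrightarrow> 0"
proof -
  interpret prob_space M using dilatively_stable_measurable(1)[OF X, of 1] by simp
  define v where "v = (\<integral>\<omega>. (X 1 \<omega>)\<^sup>2 \<partial>M)"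
  have bound: "prob {\<omega> \<in> space M. t k powr \<beta> < \<bar>X (t k) \<omega>\<bar>} \<le> v * (t k powr (\<alpha> - \<beta>))\<^sup>2" for k
  proof -
    have [measurable]: "X (t k) \<in> borel_measurable M"
      using dilatively_stable_measurable(2)[OF X] t[of k] by simp
    have int: "integrable M (\<lambda>\<omega>. X (t k) \<omega> ^ 2)"
      using X t[of k] by (simp add: dilatively_stable_def)
    have m0: "expectation (X (t k)) = 0" using mean t[of k] by simp
    have "prob {\<omega> \<in> space M. t k powr \<beta> < \<bar>X (t k) \<omega>\<bar>} \<le> prob {\<omega> \<in> space M. t k powr \<beta> \<le> \<bar>X (t k) \<omega>\<bar>}"
      by (rule finite_measure_mono) auto
    also have "\<dots> \<le> (\<integral>\<omega>. (X (t k) \<omega>)\<^sup>2 \<partial>M) / (t k powr \<beta>)\<^sup>2"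
      using Chebyshev_inequality[OF _ int, of "t k powr \<beta>"] t[of k] by (simp add: m0)
    also have "\<dots> = v * (t k powr (2 * \<alpha>) / (t k powr \<beta>)\<^sup>2)"
      using dilatively_stable_second_moment[OF X mean t[of k]] by (simp add: v_def)
    also have "t k powr (2 * \<alpha>) / (t k powr \<beta>)\<^sup>2 = (t k powr (\<alpha> - \<beta>))\<^sup>2"
      using t[of k] by (simp add: powr_diff power_divide flip: powr_power)
        (simp add: power2_eq_square flip: powr_add)
    finally show ?thesis .
  qed
  have "(\<lambda>k. v * (t k powr (\<alpha> - \<beta>))\<^sup>2) \<longlonglongrightarrow> v * 0\<^sup>2"
    by (intro tendsto_intros lim)
  then have "(\<lambda>k. v * (t k powr (\<alpha> - \<beta>))\<^sup>2) \<longlonglongrightarrow> 0" by simp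
  then show ?thesis
    by (rule tendsto_sandwich[OF _ _ tendsto_const, rotated 2])
       (auto intro!: always_eventually bound)
qed

text \<open>After rescaling by \<open>t k powr (- \<alpha>)\<close> the threshold becomes
  \<open>t k powr (\<beta> - \<alpha>)\<close>, which tends to 0, so
  \<open>no_concentration_at_0\<close> applies. The alternatives in \<open>gauss\<close> are two
  sources of its bound: one valid for every argument, or one near 0 that the rescaled arguments
  eventually reach.\<close>

lemma dilatively_stable_prob_small:
  fixes t :: "nat \<Rightarrow> real"
  assumes X: "dilatively_stable M X \<alpha> \<delta>" and mean: "\<forall>t\<ge>0. (\<integral>\<omega>. X t \<omega> \<partial>M) = 0"
    and t: "\<And>k. t k > 0" and lim: "(\<lambda>k. t k powr (\<beta> - \<alpha>)) \<longlonglongrightarrow> 0"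
    and gauss: "has_gaussian_component (distr M borel (X 1)) \<or> (\<lambda>k. t k powr (- \<delta> / 2)) \<longlonglongrightarrow> 0"
  shows "(\<lambda>k. measure M {\<omega> \<in> space M. \<bar>X (t k) \<omega>\<bar> \<le> t k powr \<beta>}) \<longlonglongrightarrow> 0"
proof -
  interpret prob_space M using dilatively_stable_measurable(1)[OF X, of 1] by simp
  have [measurable]: "X (t k) \<in> borel_measurable M" for k
    using dilatively_stable_measurable(2)[OF X] t[of k] by simp
  define \<mu> where "\<mu> k = distr M borel (\<lambda>\<omega>. t k powr (- \<alpha>) * X (t k) \<omega>)" for k
  have \<mu>: "real_distribution (\<mu> k)" for k
    unfolding \<mu>_def by (rule real_distribution_distr) simp
  obtain v where v: "v > 0" "\<And>s. \<forall>\<^sub>F k in sequentially.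
      cmod (char_of M (X 1) (s * t k powr (- \<delta> / 2))) \<le> exp (- v * (s * t k powr (- \<delta> / 2))\<^sup>2)"
    using gauss
  proof
    assume "has_gaussian_component (distr M borel (X 1))"
    then obtain v where "v > 0" "\<And>s. cmod (char_of M (X 1) s) \<le> exp (- v * s\<^sup>2)"
      by (rule has_gaussian_component_char_bound) blast
    then show thesis by (intro that[of v] always_eventually) auto
  next
    assume *: "(\<lambda>k. t k powr (- \<delta> / 2)) \<longlonglongrightarrow> 0"
    obtain v r where v: "v > 0" "r > 0" "\<And>s. \<bar>s\<bar> < r \<Longrightarrow> cmod (char_of M (X 1) s) \<le> exp (- v * s\<^sup>2)"
      by (rule char_gaussian_bound_near_0[OF X mean]) blast
    show thesis
    proof (rule that[OF v(1)])
      fix s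
      have "(\<lambda>k. \<bar>s * t k powr (- \<delta> / 2)\<bar>) \<longlonglongrightarrow> \<bar>s * 0\<bar>"
        by (intro tendsto_intros *)
      then have "\<forall>\<^sub>F k in sequentially. \<bar>s * t k powr (- \<delta> / 2)\<bar> < r"
        using v(2) by (intro order_tendstoD(2)) auto
      then show "\<forall>\<^sub>F k in sequentially.
          cmod (char_of M (X 1) (s * t k powr (- \<delta> / 2))) \<le> exp (- v * (s * t k powr (- \<delta> / 2))\<^sup>2)"
        by eventually_elim (rule v(3))
    qed
  qed
  have bound: "\<forall>\<^sub>F k in sequentially. cmod (char (\<mu> k) s) \<le> exp (- v * s\<^sup>2)" for s
    using v(2)[of s]
  proof eventually_elim
    fix k
    assume k: "cmod (char_of M (X 1) (s * t k powr (- \<delta> / 2))) \<le> exp (- v * (s * t k powr (- \<delta> / 2))\<^sup>2)"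
    have "cmod (char (\<mu> k) s) = cmod (char_of M (X 1) (s * t k powr (- \<alpha>) * t k powr (\<alpha> - \<delta> / 2))) powr (t k powr \<delta>)"
      unfolding \<mu>_def by (simp add: char_of_scale dilatively_stable_char_norm[OF X t])
    also have "s * t k powr (- \<alpha>) * t k powr (\<alpha> - \<delta> / 2) = s * t k powr (- \<delta> / 2)"
      by (simp add: mult.assoc flip: powr_add)
    also have "cmod (char_of M (X 1) (s * t k powr (- \<delta> / 2))) powr (t k powr \<delta>) \<le>
        exp (- v * (s * t k powr (- \<delta> / 2))\<^sup>2) powr (t k powr \<delta>)"
      using k by (intro powr_mono2) auto
    also have "\<dots> = exp (t k powr \<delta> * (- v * (s * t k powr (- \<delta> / 2))\<^sup>2))"
      by (simp add: powr_def)
    also have "t k powr \<delta> * (- v * (s * t k powr (- \<delta> / 2))\<^sup>2) =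
        - v * s\<^sup>2 * (t k powr \<delta> * (t k powr (- \<delta> / 2) * t k powr (- \<delta> / 2)))"
      by (simp add: power2_eq_square)
    \<comment> \<open>Scale invariance of the Gaussian bound: the outer power exactly undoes the
      squared rescaling of the argument.\<close>
    also have "t k powr \<delta> * (t k powr (- \<delta> / 2) * t k powr (- \<delta> / 2)) = 1"
      using t[of k] by (simp flip: powr_add)
    finally show "cmod (char (\<mu> k) s) \<le> exp (- v * s\<^sup>2)" by simp
  qed
  have "(\<lambda>k. measure (\<mu> k) {x. \<bar>x\<bar> \<le> t k powr (\<beta> - \<alpha>)}) \<longlonglongrightarrow> 0"
    by (rule no_concentration_at_0[OF \<mu> v(1) bound lim])
  moreover have "measure (\<mu> k) {x. \<bar>x\<bar> \<le> t k powr (\<beta> - \<alpha>)} =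
      prob {\<omega> \<in> space M. \<bar>X (t k) \<omega>\<bar> \<le> t k powr \<beta>}" for k
  proof -
    have "\<bar>t k powr (- \<alpha>) * x\<bar> \<le> t k powr (\<beta> - \<alpha>) \<longleftrightarrow> \<bar>x\<bar> \<le> t k powr \<beta>" for x
      using t[of k] by (simp add: abs_mult powr_diff powr_minus field_simps)
    then show ?thesis
      unfolding \<mu>_def by (subst measure_distr) (auto intro!: arg_cong[where f = prob])
  qed
  ultimately show ?thesis by simp
qed

section \<open>Singularity of dilatively stable processes\<close>

text \<open>The sets \<open>S k\<close> and \<open>L k\<close> are complementary, so the separation
  can be run from either side. Both orders are recorded because \<open>singular_on\<close> is not
  symmetric by its form.\<close>

lemma singular_on_if_separated_at_times:
  fixes t :: "nat \<Rightarrow> real"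
  assumes I: "I \<subseteq> {0..}" and t: "\<And>k. t k \<in> I"
    and X: "real_process M X" "AE \<omega> in M. continuous_on I (\<lambda>t. X t \<omega>)"
    and Y: "real_process N Y" "AE \<omega> in N. continuous_on I (\<lambda>t. Y t \<omega>)"
    and limX: "(\<lambda>k. measure M {\<omega> \<in> space M. b k < \<bar>X (t k) \<omega>\<bar>}) \<longlonglongrightarrow> 0"
    and limY: "(\<lambda>k. measure N {\<omega> \<in> space N. \<bar>Y (t k) \<omega>\<bar> \<le> b k}) \<longlonglongrightarrow> 0"
  shows "singular_on I M X N Y" and "singular_on I N Y M X"
proof -
  let ?P = "path_distr I M X" and ?Q = "path_distr I N Y"
  define S where "S k = {f \<in> cont_paths I. f (t k) \<in> {x. \<bar>x\<bar> \<le> b k}}" for k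
  define L where "L k = {f \<in> cont_paths I. f (t k) \<in> {x. b k < \<bar>x\<bar>}}" for k
  have [simp]: "sets (path_distr I M' X') = sets (borel_cont_paths I)"
    "space (path_distr I M' X') = cont_paths I" for M' and X' :: "real \<Rightarrow> 'x \<Rightarrow> real"
    by (simp_all add: path_distr_def)
  have [measurable]: "(\<lambda>f. f (t k)) \<in> borel_measurable (borel_cont_paths I)" for k
    by (rule borel_cont_paths_eval[OF t])
  have "{f \<in> space (borel_cont_paths I). f (t k) \<in> {x. \<bar>x\<bar> \<le> b k}} \<in> sets (borel_cont_paths I)"
    "{f \<in> space (borel_cont_paths I). f (t k) \<in> {x. b k < \<bar>x\<bar>}} \<in> sets (borel_cont_paths I)" for k
    by measurable
  then have sets: "S k \<in> sets (borel_cont_paths I)" "L k \<in> sets (borel_cont_paths I)" for k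
    by (simp_all add: S_def L_def)
  have compl: "cont_paths I - S k = L k" "cont_paths I - L k = S k" for k
    by (auto simp: S_def L_def)
  have "measure ?P (L k) = measure M {\<omega> \<in> space M. X (t k) \<omega> \<in> {x. b k < \<bar>x\<bar>}}" for k
    unfolding L_def by (rule measure_path_distr_eval[OF X(1) I X(2) t]) measurable
  then have P: "(\<lambda>k. measure ?P (L k)) \<longlonglongrightarrow> 0" using limX by simp
  have "measure ?Q (S k) = measure N {\<omega> \<in> space N. Y (t k) \<omega> \<in> {x. \<bar>x\<bar> \<le> b k}}" for k
    unfolding S_def by (rule measure_path_distr_eval[OF Y(1) I Y(2) t]) measurable
  then have Q: "(\<lambda>k. measure ?Q (S k)) \<longlonglongrightarrow> 0" using limY by simp
  note ps = prob_space_path_distr[OF X(1) I X(2)] prob_space_path_distr[OF Y(1) I Y(2)]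
  have "\<exists>A\<in>sets ?P. emeasure ?P A = 1 \<and> emeasure ?Q A = 0"
    by (rule singular_if_asymptotically_separated[OF ps, where B = S]) (simp_all add: sets compl P Q)
  then show "singular_on I M X N Y" by (simp add: singular_on_def)
  have "\<exists>A\<in>sets ?Q. emeasure ?Q A = 1 \<and> emeasure ?P A = 0"
    by (rule singular_if_asymptotically_separated[OF ps(2,1), where B = L]) (simp_all add: sets compl P Q)
  then show "singular_on I N Y M X" by (simp add: singular_on_def)
qed

lemma singular_on_dilatively_stable:
  fixes t :: "nat \<Rightarrow> real"
  assumes I: "I \<subseteq> {0..}" and t: "\<And>k. t k \<in> I" "\<And>k. t k > 0"
    and X: "dilatively_stable M X \<alpha> \<delta>" "\<forall>t\<ge>0. (\<integral>\<omega>. X t \<omega> \<partial>M) = 0"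
      "AE \<omega> in M. continuous_on I (\<lambda>t. X t \<omega>)"
    and Y: "dilatively_stable N Y \<alpha>' \<delta>'" "\<forall>t\<ge>0. (\<integral>\<omega>. Y t \<omega> \<partial>N) = 0"
      "AE \<omega> in N. continuous_on I (\<lambda>t. Y t \<omega>)"
    and lim: "(\<lambda>k. t k powr ((\<alpha> - \<alpha>') / 2)) \<longlonglongrightarrow> 0"
    and gauss: "has_gaussian_component (distr N borel (Y 1)) \<or> (\<lambda>k. t k powr (- \<delta>' / 2)) \<longlonglongrightarrow> 0"
  shows "singular_on I M X N Y" and "singular_on I N Y M X"
proof -
  \<comment> \<open>The midpoint makes the exponents for both processes equal, so the single
    hypothesis \<open>lim\<close> serves both estimates.\<close>
  define \<beta> where "\<beta> = (\<alpha> + \<alpha>') / 2"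
  have \<beta>: "\<alpha> - \<beta> = (\<alpha> - \<alpha>') / 2" "\<beta> - \<alpha>' = (\<alpha> - \<alpha>') / 2"
    by (simp_all add: \<beta>_def field_simps)
  have rp: "real_process M X" "real_process N Y"
    using X Y by (simp_all add: dilatively_stable_def)
  have limX: "(\<lambda>k. measure M {\<omega> \<in> space M. t k powr \<beta> < \<bar>X (t k) \<omega>\<bar>}) \<longlonglongrightarrow> 0"
    using dilatively_stable_prob_large[OF X(1,2) t(2)] lim by (simp add: \<beta>)
  have limY: "(\<lambda>k. measure N {\<omega> \<in> space N. \<bar>Y (t k) \<omega>\<bar> \<le> t k powr \<beta>}) \<longlonglongrightarrow> 0"
    using dilatively_stable_prob_small[OF Y(1,2) t(2) _ gauss] lim by (simp add: \<beta>)
  show "singular_on I M X N Y" and "singular_on I N Y M X"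
    by (fact singular_on_if_separated_at_times[OF I t(1) rp(1) X(3) rp(2) Y(3) limX limY])+
qed

section \<open>Times tending to an end of the interval\<close>

lemma interval_time_sequence:
  fixes I :: "real set"
  assumes I: "closed I" "is_interval I" "I \<subseteq> {0..}" "\<exists>a\<in>I. \<exists>b\<in>I. a < b"
  shows "Inf I = 0 \<Longrightarrow> \<exists>t :: nat \<Rightarrow> real. (\<forall>k. t k \<in> I \<and> t k > 0) \<and> (\<forall>p>0. (\<lambda>k. t k powr p) \<longlonglongrightarrow> 0)"
    and "\<not> bdd_above I \<Longrightarrow> \<exists>t :: nat \<Rightarrow> real. (\<forall>k. t k \<in> I \<and> t k > 0) \<and> (\<forall>p<0. (\<lambda>k. t k powr p) \<longlonglongrightarrow> 0)"
proof -
  obtain b where b: "b \<in> I" "b > 0" using I by fastforce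
  {
    assume "Inf I = 0"
    \<comment> \<open>Closedness puts 0 into \<open>I\<close>, so the interval contains everything
      between 0 and \<open>b\<close>.\<close>
    moreover have "Inf I \<in> I"
      using I b by (intro closed_contains_Inf) (auto intro!: bdd_belowI[of _ 0])
    ultimately have "0 \<in> I" by simp
    define t where "t k = b * inverse (real (Suc k))" for k
    have "t k > 0" "t k \<le> b" for k
      using b by (auto simp: t_def field_simps)
    then have "t k \<in> I \<and> t k > 0" for k
      using mem_is_interval_1_I[OF I(2) \<open>0 \<in> I\<close> b(1), of "t k"] less_imp_le by blast
    moreover have "t \<longlonglongrightarrow> 0"
      unfolding t_def using tendsto_mult_left[OF LIMSEQ_inverse_real_of_nat, of b] by simp
    have "(\<lambda>k. t k powr p) \<longlonglongrightarrow> 0 powr p" if "p > 0" for p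
      using that \<open>\<And>k. t k > 0\<close>
      by (intro tendsto_powr'[OF \<open>t \<longlonglongrightarrow> 0\<close> tendsto_const]) (simp add: less_imp_le)
    then have "(\<lambda>k. t k powr p) \<longlonglongrightarrow> 0" if "p > 0" for p
      using that by simp
    ultimately show "\<exists>t :: nat \<Rightarrow> real. (\<forall>k. t k \<in> I \<and> t k > 0) \<and> (\<forall>p>0. (\<lambda>k. t k powr p) \<longlonglongrightarrow> 0)"
      by blast
  }
  {
    assume unb: "\<not> bdd_above I"
    define t where "t k = b + real k" for k
    have "t k \<in> I \<and> t k > 0" for k
    proof -
      \<comment> \<open>Unboundedness supplies a point of \<open>I\<close> beyond
        \<open>t k\<close>, so \<open>t k\<close> lies between two points of the interval.\<close>
      obtain y where "y \<in> I" "t k < y" using unb unfolding bdd_above_def by (meson not_le)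
      then show ?thesis
        using mem_is_interval_1_I[OF I(2) b(1), of y "t k"] b(2) by (simp add: t_def)
    qed
    moreover have "filterlim t at_top sequentially"
      unfolding t_def by (rule filterlim_tendsto_add_at_top[OF tendsto_const filterlim_real_sequentially])
    then have "(\<lambda>k. t k powr p) \<longlonglongrightarrow> 0" if "p < 0" for p
      by (rule tendsto_neg_powr[OF that])
    ultimately show "\<exists>t :: nat \<Rightarrow> real. (\<forall>k. t k \<in> I \<and> t k > 0) \<and> (\<forall>p<0. (\<lambda>k. t k powr p) \<longlonglongrightarrow> 0)"
      by blast
  }
qed

theorem theorem3p1:
  fixes I :: "real set"
    and M\<^sub>1 :: "'a measure" and X\<^sub>1 :: "real \<Rightarrow> 'a \<Rightarrow> real"
    and M\<^sub>2 :: "'b measure" and X\<^sub>2 :: "real \<Rightarrow> 'b \<Rightarrow> real"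
    and \<alpha>\<^sub>1 \<delta>\<^sub>1 \<alpha>\<^sub>2 \<delta>\<^sub>2 :: real
  assumes "closed I" and "is_interval I" and "I \<subseteq> {0..}" and "\<exists>a\<in>I. \<exists>b\<in>I. a < b"
    and "dilatively_stable M\<^sub>1 X\<^sub>1 \<alpha>\<^sub>1 \<delta>\<^sub>1"
    and "dilatively_stable M\<^sub>2 X\<^sub>2 \<alpha>\<^sub>2 \<delta>\<^sub>2"
    and "\<forall>t\<ge>0. (\<integral>\<omega>. X\<^sub>1 t \<omega> \<partial>M\<^sub>1) = 0"
    and "\<forall>t\<ge>0. (\<integral>\<omega>. X\<^sub>2 t \<omega> \<partial>M\<^sub>2) = 0"
    and "AE \<omega> in M\<^sub>1. continuous_on I (\<lambda>t. X\<^sub>1 t \<omega>)"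
    and "AE \<omega> in M\<^sub>2. continuous_on I (\<lambda>t. X\<^sub>2 t \<omega>)"
    and "(Inf I = 0 \<and>
            (\<delta>\<^sub>1 \<ge> 0 \<longrightarrow> has_gaussian_component (distr M\<^sub>1 borel (X\<^sub>1 1))) \<and>
            (\<delta>\<^sub>2 \<ge> 0 \<longrightarrow> has_gaussian_component (distr M\<^sub>2 borel (X\<^sub>2 1)))) \<or>
         (\<not> bdd_above I \<and>
            (\<delta>\<^sub>1 \<le> 0 \<longrightarrow> has_gaussian_component (distr M\<^sub>1 borel (X\<^sub>1 1))) \<and>
            (\<delta>\<^sub>2 \<le> 0 \<longrightarrow> has_gaussian_component (distr M\<^sub>2 borel (X\<^sub>2 1))))"
    and "\<alpha>\<^sub>1 \<noteq> \<alpha>\<^sub>2"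
  shows "singular_on I M\<^sub>1 X\<^sub>1 M\<^sub>2 X\<^sub>2"
proof -
  note X\<^sub>1 = assms(5,7,9) and X\<^sub>2 = assms(6,8,10)
  show ?thesis
    using assms(11)
  proof (elim disjE conjE)
    assume I0: "Inf I = 0"
      and g1: "\<delta>\<^sub>1 \<ge> 0 \<longrightarrow> has_gaussian_component (distr M\<^sub>1 borel (X\<^sub>1 1))"
      and g2: "\<delta>\<^sub>2 \<ge> 0 \<longrightarrow> has_gaussian_component (distr M\<^sub>2 borel (X\<^sub>2 1))"
    obtain t :: "nat \<Rightarrow> real" where t: "\<And>k. t k \<in> I" "\<And>k. t k > 0"
      and lim: "\<And>p. p > 0 \<Longrightarrow> (\<lambda>k. t k powr p) \<longlonglongrightarrow> 0"
      using interval_time_sequence(1)[OF assms(1-4) I0] by blast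
    \<comment> \<open>For negative \<open>\<delta>\<^sub>1\<close> the exponent
      \<open>- \<delta>\<^sub>1 / 2\<close> is positive, so the power vanishes as the times tend to
      0.\<close>
    have h1: "has_gaussian_component (distr M\<^sub>1 borel (X\<^sub>1 1)) \<or> (\<lambda>k. t k powr (- \<delta>\<^sub>1 / 2)) \<longlonglongrightarrow> 0"
      using g1 lim[of "- \<delta>\<^sub>1 / 2"] by (cases "\<delta>\<^sub>1 \<ge> 0") auto
    have h2: "has_gaussian_component (distr M\<^sub>2 borel (X\<^sub>2 1)) \<or> (\<lambda>k. t k powr (- \<delta>\<^sub>2 / 2)) \<longlonglongrightarrow> 0"
      using g2 lim[of "- \<delta>\<^sub>2 / 2"] by (cases "\<delta>\<^sub>2 \<ge> 0") auto
    show ?thesis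
    \<comment> \<open>Near time 0 the process with the larger \<open>\<alpha>\<close> is the smaller
      one; the other needs the anti-concentration estimate.\<close>
    proof (cases "\<alpha>\<^sub>1 < \<alpha>\<^sub>2")
      case True
      then show ?thesis
        by (intro singular_on_dilatively_stable(2)[OF assms(3) t X\<^sub>2 X\<^sub>1 _ h1] lim) simp
    next
      case False
      with assms(12) show ?thesis
        by (intro singular_on_dilatively_stable(1)[OF assms(3) t X\<^sub>1 X\<^sub>2 _ h2] lim) simp
    qed
  next
    assume unb: "\<not> bdd_above I"
      and g1: "\<delta>\<^sub>1 \<le> 0 \<longrightarrow> has_gaussian_component (distr M\<^sub>1 borel (X\<^sub>1 1))"
      and g2: "\<delta>\<^sub>2 \<le> 0 \<longrightarrow> has_gaussian_component (distr M\<^sub>2 borel (X\<^sub>2 1))"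
    obtain t :: "nat \<Rightarrow> real" where t: "\<And>k. t k \<in> I" "\<And>k. t k > 0"
      and lim: "\<And>p. p < 0 \<Longrightarrow> (\<lambda>k. t k powr p) \<longlonglongrightarrow> 0"
      using interval_time_sequence(2)[OF assms(1-4) unb] by blast
    have h1: "has_gaussian_component (distr M\<^sub>1 borel (X\<^sub>1 1)) \<or> (\<lambda>k. t k powr (- \<delta>\<^sub>1 / 2)) \<longlonglongrightarrow> 0"
      using g1 lim[of "- \<delta>\<^sub>1 / 2"] by (cases "\<delta>\<^sub>1 \<le> 0") auto
    have h2: "has_gaussian_component (distr M\<^sub>2 borel (X\<^sub>2 1)) \<or> (\<lambda>k. t k powr (- \<delta>\<^sub>2 / 2)) \<longlonglongrightarrow> 0"
      using g2 lim[of "- \<delta>\<^sub>2 / 2"] by (cases "\<delta>\<^sub>2 \<le> 0") auto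
    show ?thesis
    \<comment> \<open>At infinity the roles are reversed: the process with the smaller
      \<open>\<alpha>\<close> is dominated.\<close>
    proof (cases "\<alpha>\<^sub>1 < \<alpha>\<^sub>2")
      case True
      then show ?thesis
        by (intro singular_on_dilatively_stable(1)[OF assms(3) t X\<^sub>1 X\<^sub>2 _ h2] lim) simp
    next
      case False
      with assms(12) show ?thesis
        by (intro singular_on_dilatively_stable(2)[OF assms(3) t X\<^sub>2 X\<^sub>1 _ h1] lim) simp
    qed
  qed
qed

end
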